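(* Let $\Omega\subset\mathbb{O}$ be a domain. If $f:\Omega\to\mathbb{O}$ is a nonconstant slice Fueter-regular function, then for every $\mathbb{I}\in\mathcal{N}$ the function $|f_{\mathbb{I}}|:\Omega_{\mathbb{I}}\to\mathbb{R}$ has no local maximum.
   Context: Octonions. $\mathbb{O}$ is the real (non-associative) division algebra with basis $e_0=1,e_1,\dots,e_7$, with $e_l e_l=-1$ for $l\ge 1$ and $e_le_m=\sum_n\epsilon_{lmn}e_n$ for $l\ne m$ in $\{1,\dots,7\}$, where $\epsilon_{lmn}$ is completely antisymmetric, equal to $1$ on $(1,2,3),(1,4,5),(1,7,6),(2,4,6),(2,5,7),(3,4,7),(3,6,5)$, and $0$ on triples that are not permutations of these. For $x=\sum_{l=0}^7x_le_l$: $\Re(x)=x_0$, $\Im(x)=\sum_{l=1}^7x_le_l$, $|x|=(\sum x_l^2)^{1/2}$. $\mathbb{O}=\mathbb{R}^8$ carries the Euclidean topology; a domain is a nonempty connected open set. $\mathbb{S}=\{I\in\mathbb{O}:\Re(I)=0,|I|=1\}$. Slice functions. For $a\in\mathbb{R}$, $b>0$ let $\mathbb{S}(\Omega,a,b)=\{I\in\mathbb{S}: a+bI\in\Omega\}$. A function $f:\Omega\to\mathbb{O}$ is a slice function if for every connected component $\Lambda$ of any nonempty $\mathbb{S}(\Omega,a,b)$ there is $(u,v)\in\mathbb{O}^2$ with $f(a+bI)=u+Iv$ for all $I\in\Lambda$. Slice Fueter-regularity. Let $L_{mn}=x_m\frac{\partial}{\partial x_n}-x_n\frac{\partial}{\partial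 x_m}$ ($1\le m<n\le 7$), $\Gamma f=-\sum_{1\le m<n\le 7}e_m(e_n(L_{mn}f))$, $E=\sum_{l=1}^7x_l\frac{\partial}{\partial x_l}$, and $\overline{\partial}_Ff(x)=\frac{\partial f}{\partial x_0}(x)-\Im(x)^{-1}Ef(x)-\frac13\Im(x)^{-1}\Gamma f(x)$ for $x\in\Omega\setminus\mathbb{R}$. A slice function $f:\Omega\to\mathbb{O}$ of class $\mathcal{C}^1$ (in the real variables $x_0,\dots,x_7$) is slice Fueter-regular if $\overline{\partial}_Ff\equiv0$ on $\Omega\setminus\mathbb{R}$. Quaternion slices. $\mathcal{N}$ is the set of ordered pairs $\mathbb{I}=(I,J)$ of orthogonal elements of $\mathbb{S}$; $\mathbb{H}_{\mathbb{I}}$ is the subalgebra of $\mathbb{O}$ generated by $I,J$ (isomorphic to the quaternions); $\Omega_{\mathbb{I}}=\Omega\cap\mathbb{H}_{\mathbb{I}}$ (with the topology of $\mathbb{H}_{\mathbb{I}}$), and $f_{\mathbb{I}}=f|_{\Omega_{\mathbb{I}}}$. A local maximum is understood in the non-strict sense. *)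

theory Defs
  imports "HOL-Analysis.Analysis" "HOL-Library.Numeral_Type"
begin

section \<open>Octonions\<close>

text \<open>
  The index type \<open>8\<close> consists of the residues \<open>0, ..., 7\<close>, ordered in this way, so that the
  coordinates of an octonion are \<open>x $ 0, ..., x $ 7\<close>. The library's \<open>*\<close>, \<open>1\<close> and \<open>inverse\<close> on vectors
  are not the octonionic ones (\<open>*\<close> is componentwise, for example) and are not used; the unit of the
  octonions is \<open>oct_e 0\<close>.
\<close>

type_synonym octonion = "real ^ 8"

definition oct_e :: "8 \<Rightarrow> octonion" where
  "oct_e l = axis l 1"

definition oct_triples :: "(8 \<times> 8 \<times> 8) set" where
  "oct_triples = {(1,2,3), (1,4,5), (1,7,6), (2,4,6), (2,5,7), (3,4,7), (3,6,5)}"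

definition oct_eps :: "8 \<Rightarrow> 8 \<Rightarrow> 8 \<Rightarrow> real" where
  "oct_eps l m n =
    (if (l,m,n) \<in> oct_triples \<or> (m,n,l) \<in> oct_triples \<or> (n,l,m) \<in> oct_triples then 1
     else if (m,l,n) \<in> oct_triples \<or> (l,n,m) \<in> oct_triples \<or> (n,m,l) \<in> oct_triples then - 1
     else 0)"

definition oct_basis_mult :: "8 \<Rightarrow> 8 \<Rightarrow> octonion" where
  "oct_basis_mult l m =
    (if l = 0 then oct_e m
     else if m = 0 then oct_e l
     else if l = m then - oct_e 0
     else (\<Sum>n | n \<noteq> 0. oct_eps l m n *\<^sub>R oct_e n))"

definition oct_mult :: "octonion \<Rightarrow> octonion \<Rightarrow> octonion"  (infixl "\<odot>" 70) where
  "x \<odot> y = (\<Sum>l\<in>UNIV. \<Sum>m\<in>UNIV. (x $ l * y $ m) *\<^sub>R oct_basis_mult l m)"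

definition oct_Re :: "octonion \<Rightarrow> real" where
  "oct_Re x = x $ 0"

definition oct_Im :: "octonion \<Rightarrow> octonion" where
  "oct_Im x = (\<Sum>l | l \<noteq> 0. x $ l *\<^sub>R oct_e l)"

definition oct_of_real :: "real \<Rightarrow> octonion" where
  "oct_of_real a = a *\<^sub>R oct_e 0"

definition oct_cnj :: "octonion \<Rightarrow> octonion" where
  "oct_cnj x = oct_of_real (oct_Re x) - oct_Im x"

definition oct_inv :: "octonion \<Rightarrow> octonion" where
  "oct_inv x = (1 / (norm x)\<^sup>2) *\<^sub>R oct_cnj x"

definition oct_sphere :: "octonion set" where
  "oct_sphere = {I. oct_Re I = 0 \<and> norm I = 1}"


section \<open>Slice functions\<close>

text \<open>
  A function on \<open>\<Omega>\<close> is a total function of which only the values on \<open>\<Omega>\<close> are used.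
\<close>

definition slice_sphere :: "octonion set \<Rightarrow> real \<Rightarrow> real \<Rightarrow> octonion set" where
  "slice_sphere \<Omega> a b = {I \<in> oct_sphere. oct_of_real a + b *\<^sub>R I \<in> \<Omega>}"

definition slice_function :: "octonion set \<Rightarrow> (octonion \<Rightarrow> octonion) \<Rightarrow> bool" where
  "slice_function \<Omega> f \<longleftrightarrow>
    (\<forall>a b. b > 0 \<longrightarrow> (\<forall>\<Lambda> \<in> components (slice_sphere \<Omega> a b).
       \<exists>u v. \<forall>I\<in>\<Lambda>. f (oct_of_real a + b *\<^sub>R I) = u + I \<odot> v))"


section \<open>Slice Fueter-regular functions\<close>

definition C1_on :: "octonion set \<Rightarrow> (octonion \<Rightarrow> octonion) \<Rightarrow> bool" where
  "C1_on \<Omega> f \<longleftrightarrow>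
    (\<exists>f' :: octonion \<Rightarrow> octonion \<Rightarrow>\<^sub>L octonion.
       (\<forall>x\<in>\<Omega>. (f has_derivative blinfun_apply (f' x)) (at x)) \<and> continuous_on \<Omega> f')"

definition oct_partial :: "8 \<Rightarrow> (octonion \<Rightarrow> octonion) \<Rightarrow> octonion \<Rightarrow> octonion" where
  "oct_partial n f x = vector_derivative (\<lambda>t. f (x + t *\<^sub>R oct_e n)) (at 0)"

definition oct_L :: "8 \<Rightarrow> 8 \<Rightarrow> (octonion \<Rightarrow> octonion) \<Rightarrow> octonion \<Rightarrow> octonion" where
  "oct_L m n f x = x $ m *\<^sub>R oct_partial n f x - x $ n *\<^sub>R oct_partial m f x"

definition oct_Gamma :: "(octonion \<Rightarrow> octonion) \<Rightarrow> octonion \<Rightarrow> octonion" where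
  "oct_Gamma f x = - (\<Sum>(m, n) | 0 < m \<and> m < n. oct_e m \<odot> (oct_e n \<odot> oct_L m n f x))"

definition oct_Euler :: "(octonion \<Rightarrow> octonion) \<Rightarrow> octonion \<Rightarrow> octonion" where
  "oct_Euler f x = (\<Sum>l | l \<noteq> 0. x $ l *\<^sub>R oct_partial l f x)"

definition dbar_F :: "(octonion \<Rightarrow> octonion) \<Rightarrow> octonion \<Rightarrow> octonion" where
  "dbar_F f x = oct_partial 0 f x - oct_inv (oct_Im x) \<odot> oct_Euler f x
     - (1 / 3) *\<^sub>R (oct_inv (oct_Im x) \<odot> oct_Gamma f x)"

definition slice_Fueter_regular :: "octonion set \<Rightarrow> (octonion \<Rightarrow> octonion) \<Rightarrow> bool" where
  "slice_Fueter_regular \<Omega> f \<longleftrightarrow>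
    slice_function \<Omega> f \<and> C1_on \<Omega> f \<and> (\<forall>x \<in> \<Omega> - range oct_of_real. dbar_F f x = 0)"


section \<open>Quaternionic slices\<close>

definition oct_orth_pairs :: "(octonion \<times> octonion) set" where
  "oct_orth_pairs = {(I, J). I \<in> oct_sphere \<and> J \<in> oct_sphere \<and> orthogonal I J}"

definition oct_subalgebra :: "octonion set \<Rightarrow> bool" where
  "oct_subalgebra A \<longleftrightarrow> subspace A \<and> oct_e 0 \<in> A \<and> (\<forall>x\<in>A. \<forall>y\<in>A. x \<odot> y \<in> A)"

definition quat_slice :: "octonion \<times> octonion \<Rightarrow> octonion set" where
  "quat_slice = (\<lambda>(I, J). oct_subalgebra hull {I, J})"

text \<open>Non-strict local maximum of \<open>g\<close> on \<open>S\<close>, with respect to the subspace topology of \<open>S\<close>.\<close>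

definition local_max_on :: "('a::topological_space \<Rightarrow> real) \<Rightarrow> 'a set \<Rightarrow> 'a \<Rightarrow> bool" where
  "local_max_on g S p \<longleftrightarrow> p \<in> S \<and> (\<forall>\<^sub>F y in at p within S. g y \<le> g p)"

end

theory Submission
  imports Defs "HOL-Complex_Analysis.Conformal_Mappings"
begin

text \<open>
  Near a point \<open>a + b I\<close> with \<open>b > 0\<close> write \<open>f = u + I v\<close> with \<open>u\<close>, \<open>v\<close> functions of \<open>(a, b)\<close>. The equation
  \<open>dbar_F f = 0\<close> then says \<open>u\<^sub>a = v\<^sub>b + 2 v / b\<close> and \<open>u\<^sub>b = - v\<^sub>a\<close>, separately for each
  real component. By the second equation \<open>u da - v db\<close> has a potential \<open>S\<close>, and \<open>S - b v + \<i> b u\<close> is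
  holomorphic; hence \<open>u\<close> and \<open>v\<close> are smooth, they enjoy unique continuation, and the real components of
  \<open>f\<close> on a quaternionic slice are harmonic off the real axis.

  If \<open>|f|\<close> has a local maximum at \<open>p\<close> on the slice, so does the harmonic function \<open>f \<bullet> c\<close> for
  \<open>c = f p / |f p|\<close>. Hopf's boundary point lemma, applied to a ball touching the set where the maximum
  is attained, shows that \<open>f\<close> is constant near some non-real point of the slice. On the real axis, where
  only \<open>C\<^sup>1\<close> regularity is available, the ball is chosen tangent to the axis at \<open>p\<close>. Constancy on an
  open piece of the slice forces \<open>v = 0\<close> and \<open>u\<close> constant there, and unique continuation spreads it over
  the domain.
\<close>

section \<open>Octonion algebra\<close>

text \<open>Harmonicity involves second derivatives, while the equation is posed for a C^1 function.
  The way out is one complex variable: the operator u_aa + u_bb + 2 u_b / b is, up to the factor b,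
  the plane Laplacian of b u, so b u should be the imaginary part of a holomorphic function. The
  coefficient 2 belongs to rotations of a 3-dimensional space: the seven imaginary directions of the
  octonions contribute 6, and the factor 1/3 in \<open>dbar_F\<close> reduces it to 2. Hence the
  4-dimensional slices are the place to look for harmonic components. Real components are used
  because right multiplication by a constant need not preserve the form u + I v without
  associativity, whereas the system for u and v has real coefficients. A slice function on a general
  domain has no global u and v; the pair belongs to one connected set of directions. Hence the
  argument runs in charts: caps of directions at nonreal points, the whole sphere over a half-disc
  at real points, which carries constancy across the axis. Hopf's lemma fits better than mean
  values: it asks for harmonicity only inside a ball and for one derivative at the touching
  point.\<close>

lemma UNIV_8: "(UNIV :: 8 set) = {0,1,2,3,4,5,6,7}"
proof -
  have "card {0,1,2,3,4,5,6,7::8} = 8" by simp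
  then show ?thesis using card_subset_eq[of "UNIV::8 set" "{0,1,2,3,4,5,6,7}"] by simp
qed

lemma sum_8: "(\<Sum>i\<in>UNIV. g (i::8)) = g 0 + g 1 + g 2 + g 3 + g 4 + g 5 + g 6 + g 7"
  unfolding UNIV_8 by (simp add: add.assoc)

lemma forall_8: "(\<forall>i::8. P i) \<longleftrightarrow> P 0 \<and> P 1 \<and> P 2 \<and> P 3 \<and> P 4 \<and> P 5 \<and> P 6 \<and> P 7"
proof -
  have "(\<forall>i::8. P i) \<longleftrightarrow> (\<forall>i\<in>(UNIV::8 set). P i)" by simp
  also have "\<dots> \<longleftrightarrow> P 0 \<and> P 1 \<and> P 2 \<and> P 3 \<and> P 4 \<and> P 5 \<and> P 6 \<and> P 7"
    unfolding UNIV_8 by simp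
  finally show ?thesis .
qed

lemma nonzero_8: "{n::8. n \<noteq> 0} = {1,2,3,4,5,6,7}"
  using UNIV_8 by auto

lemma oct_e_nth: "oct_e l $ i = (if i = l then 1 else 0)"
  by (simp add: oct_e_def axis_def)

lemma oct_basis_mult_nth:
  "oct_basis_mult l m $ i =
    (if l = 0 then (if i = m then 1 else 0)
     else if m = 0 then (if i = l then 1 else 0)
     else if l = m then (if i = 0 then - 1 else 0)
     else if i = 0 then 0 else oct_eps l m i)"
proof -
  have "(\<Sum>n | n \<noteq> 0. oct_eps l m n *\<^sub>R oct_e n) $ i = (\<Sum>n | n \<noteq> 0. if i = n then oct_eps l m n else 0)"
    unfolding sum_component by (rule sum.cong) (simp_all add: oct_e_nth)
  also have "\<dots> = (if i = 0 then 0 else oct_eps l m i)"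
    by (subst sum.delta') auto
  finally show ?thesis
    by (auto simp: oct_basis_mult_def oct_e_nth)
qed

lemma oct_mult_nth: "(x \<odot> y) $ i = (\<Sum>l\<in>UNIV. \<Sum>m\<in>UNIV. x $ l * y $ m * oct_basis_mult l m $ i)"
  by (simp add: oct_mult_def)

lemma oct_mult_coords:
  "(x \<odot> y) $ 0 = x$0*y$0 - x$1*y$1 - x$2*y$2 - x$3*y$3 - x$4*y$4 - x$5*y$5 - x$6*y$6 - x$7*y$7"
  "(x \<odot> y) $ 1 = x$0*y$1 + x$1*y$0 + x$2*y$3 - x$3*y$2 + x$4*y$5 - x$5*y$4 + x$7*y$6 - x$6*y$7"
  "(x \<odot> y) $ 2 = x$0*y$2 + x$2*y$0 + x$3*y$1 - x$1*y$3 + x$4*y$6 - x$6*y$4 + x$5*y$7 - x$7*y$5"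
  "(x \<odot> y) $ 3 = x$0*y$3 + x$3*y$0 + x$1*y$2 - x$2*y$1 + x$4*y$7 - x$7*y$4 + x$6*y$5 - x$5*y$6"
  "(x \<odot> y) $ 4 = x$0*y$4 + x$4*y$0 + x$5*y$1 - x$1*y$5 + x$6*y$2 - x$2*y$6 + x$7*y$3 - x$3*y$7"
  "(x \<odot> y) $ 5 = x$0*y$5 + x$5*y$0 + x$1*y$4 - x$4*y$1 + x$7*y$2 - x$2*y$7 + x$3*y$6 - x$6*y$3"
  "(x \<odot> y) $ 6 = x$0*y$6 + x$6*y$0 + x$1*y$7 - x$7*y$1 + x$2*y$4 - x$4*y$2 + x$5*y$3 - x$3*y$5"
  "(x \<odot> y) $ 7 = x$0*y$7 + x$7*y$0 + x$6*y$1 - x$1*y$6 + x$2*y$5 - x$5*y$2 + x$3*y$4 - x$4*y$3"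
  unfolding oct_mult_nth sum_8 oct_basis_mult_nth oct_eps_def oct_triples_def
  by simp_all

lemma oct_eq_iff: "x = y \<longleftrightarrow> x$0 = y$0 \<and> x$1 = y$1 \<and> x$2 = y$2 \<and> x$3 = y$3 \<and> x$4 = y$4 \<and> x$5 = y$5
    \<and> x$6 = y$6 \<and> x$7 = y$7" for x y :: octonion
  by (simp add: vec_eq_iff forall_8)

lemma oct_inner_coords: "x \<bullet> y = x$0*y$0 + x$1*y$1 + x$2*y$2 + x$3*y$3 + x$4*y$4 + x$5*y$5 + x$6*y$6 + x$7*y$7"
  for x y :: octonion
  by (simp add: inner_vec_def sum_8)

interpretation oct_mult: bounded_bilinear "(\<odot>)"
proof -
  have "bilinear (\<odot>)"
    unfolding bilinear_def
    by (auto intro!: linearI simp: oct_eq_iff oct_mult_coords algebra_simps)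
  then show "bounded_bilinear (\<odot>)"
    by (simp add: bilinear_conv_bounded_bilinear)
qed

lemma oct_e0_mult [simp]: "oct_e 0 \<odot> x = x" "x \<odot> oct_e 0 = x"
  by (simp_all add: oct_eq_iff oct_mult_coords oct_e_nth)

text \<open>Left alternativity w(wx) = (ww)x with ww = -|w|^2 is the substitute for associativity.
  Together with bilinearity, the unit and \<open>oct_mult_skew\<close>, it is all that later proofs
  take from the multiplication table.\<close>

lemma oct_mult_left_alt:
  assumes "w $ 0 = 0"
  shows "w \<odot> (w \<odot> x) = - ((norm w)\<^sup>2 *\<^sub>R x)"
  unfolding power2_norm_eq_inner
  by (simp add: oct_eq_iff oct_mult_coords oct_inner_coords assms) (intro conjI; algebra)

text \<open>The adjoint of left multiplication by w is left multiplication by the conjugate of w,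
  which is -w for imaginary w.\<close>

lemma oct_mult_skew:
  assumes "w $ 0 = 0"
  shows "(w \<odot> x) \<bullet> y = - (x \<bullet> (w \<odot> y))"
  by (simp add: oct_inner_coords oct_mult_coords assms) algebra

lemma oct_Re_inner: "x $ 0 = x \<bullet> oct_e 0"
  by (simp add: oct_inner_coords oct_e_nth)

lemma norm_oct_e [simp]: "norm (oct_e l) = 1"
  by (simp add: oct_e_def)

lemma oct_Im_eq: "oct_Im x = x - x $ 0 *\<^sub>R oct_e 0"
proof -
  have "oct_Im x = x $ 1 *\<^sub>R oct_e 1 + (x $ 2 *\<^sub>R oct_e 2 + (x $ 3 *\<^sub>R oct_e 3 + (x $ 4 *\<^sub>R oct_e 4
      + (x $ 5 *\<^sub>R oct_e 5 + (x $ 6 *\<^sub>R oct_e 6 + x $ 7 *\<^sub>R oct_e 7)))))"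
    unfolding oct_Im_def nonzero_8 by simp
  then show ?thesis by (simp add: oct_eq_iff oct_e_nth)
qed

lemma oct_Im_Re [simp]: "oct_Im x $ 0 = 0"
  by (simp add: oct_Im_eq oct_e_nth)

lemma oct_sphere_iff: "I \<in> oct_sphere \<longleftrightarrow> I $ 0 = 0 \<and> norm I = 1"
  by (simp add: oct_sphere_def oct_Re_def)

text \<open>Polarization of \<open>oct_mult_left_alt\<close> at w + z: left multiplications by
  imaginary octonions satisfy the Clifford relations as operators.\<close>

lemma oct_mult_polar:
  assumes "w $ 0 = 0" "z $ 0 = 0"
  shows "w \<odot> (z \<odot> x) + z \<odot> (w \<odot> x) = - ((2 * (w \<bullet> z)) *\<^sub>R x)"
proof -
  have "(w + z) \<odot> ((w + z) \<odot> x) = - ((norm (w + z))\<^sup>2 *\<^sub>R x)"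
    by (rule oct_mult_left_alt) (simp add: assms)
  then show ?thesis
    using oct_mult_left_alt[OF assms(1), of x] oct_mult_left_alt[OF assms(2), of x]
    by (simp add: oct_mult.add_left oct_mult.add_right power2_norm_eq_inner eq_neg_iff_add_eq_0
        inner_commute[of z w] algebra_simps scaleR_2)
qed

lemma oct_mult_anticommute:
  assumes "w $ 0 = 0" "z $ 0 = 0"
  shows "w \<odot> z + z \<odot> w = - ((2 * (w \<bullet> z)) *\<^sub>R oct_e 0)"
  using oct_mult_polar[OF assms, of "oct_e 0"] by simp

lemma oct_sphere_square:
  assumes "I \<in> oct_sphere"
  shows "I \<odot> (I \<odot> x) = - x"
  using oct_mult_left_alt[of I x] assms by (simp add: oct_sphere_iff)

lemma oct_mult_eq_0_imag:
  assumes "w $ 0 = 0" "w \<noteq> 0" "w \<odot> x = 0"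
  shows "x = 0"
  using oct_mult_left_alt[OF assms(1), of x] assms(2,3) by (simp add: oct_mult.zero_right)

lemma norm_oct_mult_imag:
  assumes "w $ 0 = 0"
  shows "norm (w \<odot> x) = norm w * norm x"
proof -
  have "(norm (w \<odot> x))\<^sup>2 = (norm w * norm x)\<^sup>2"
    unfolding power2_norm_eq_inner oct_mult_skew[OF assms] oct_mult_left_alt[OF assms]
    by (simp add: power_mult_distrib flip: power2_norm_eq_inner)
  then show ?thesis by simp
qed

lemma oct_inv_imag:
  assumes "I \<in> oct_sphere" "b > 0"
  shows "oct_inv (b *\<^sub>R I) = - ((1 / b) *\<^sub>R I)"
  using assms by (simp add: oct_inv_def oct_cnj_def oct_Im_eq oct_of_real_def oct_Re_def oct_sphere_iff
      power2_eq_square)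

text \<open>The quaternion relations for the triple I, J, IJ. Each product has a repeated factor, so
  alternativity and the anticommutation of orthogonal imaginary units suffice.\<close>

lemma oct_sphere_mult:
  assumes "I \<in> oct_sphere" "J \<in> oct_sphere" "orthogonal I J"
  shows "I \<odot> J \<in> oct_sphere" "orthogonal I (I \<odot> J)" "orthogonal J (I \<odot> J)"
    "I \<odot> (I \<odot> J) = - J" "J \<odot> (I \<odot> J) = I" "I \<odot> I = - oct_e 0"
    "J \<odot> I = - (I \<odot> J)" "(I \<odot> J) \<odot> I = J" "(I \<odot> J) \<odot> J = - I"
proof -
  have I: "I $ 0 = 0" "norm I = 1" and J: "J $ 0 = 0" "norm J = 1" and 0: "I \<bullet> J = 0"
    using assms by (auto simp: oct_sphere_iff orthogonal_def)
  have sq: "I \<odot> (I \<odot> x) = - x" "J \<odot> (J \<odot> x) = - x" for x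
    using assms oct_sphere_square by auto
  show II: "I \<odot> I = - oct_e 0" using sq(1)[of "oct_e 0"] by simp
  show JI: "J \<odot> I = - (I \<odot> J)"
    using oct_mult_anticommute[OF I(1) J(1)] 0 by (simp add: eq_neg_iff_add_eq_0 add.commute)
  show IIJ: "I \<odot> (I \<odot> J) = - J" by (rule sq)
  show JIJ: "J \<odot> (I \<odot> J) = I"
    using sq(2)[of I] JI by (simp add: oct_mult.minus_right)
  have re: "(I \<odot> J) $ 0 = 0"
    using oct_mult_skew[OF I(1), of J "oct_e 0"] 0 by (simp add: oct_Re_inner inner_commute)
  then show S: "I \<odot> J \<in> oct_sphere"
    by (simp add: oct_sphere_iff norm_oct_mult_imag I J)
  show oI: "orthogonal I (I \<odot> J)"
    using oct_mult_skew[OF I(1), of J I] oct_sphere_iff J II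
    by (simp add: orthogonal_def inner_commute flip: oct_Re_inner)
  show oJ: "orthogonal J (I \<odot> J)"
    using oct_mult_skew[OF I(1), of J J] by (simp add: orthogonal_def inner_commute)
  show "(I \<odot> J) \<odot> I = J"
    using oct_mult_anticommute[OF I(1) re] oI IIJ by (simp add: orthogonal_def add.commute eq_neg_iff_add_eq_0)
  show "(I \<odot> J) \<odot> J = - I"
    using oct_mult_anticommute[OF J(1) re] oJ JIJ by (simp add: orthogonal_def add.commute eq_neg_iff_add_eq_0)
qed

text \<open>For orthogonal imaginary units I and J these are the images of 1, i, j, k under an
  embedding of the quaternions.\<close>

definition quat_frame :: "octonion \<Rightarrow> octonion \<Rightarrow> octonion set" where
  "quat_frame I J = {oct_e 0, I, J, I \<odot> J}"

lemma quat_frame_orthonormal: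
  assumes "I \<in> oct_sphere" "J \<in> oct_sphere" "orthogonal I J"
  shows "pairwise orthogonal (quat_frame I J)" "\<And>x. x \<in> quat_frame I J \<Longrightarrow> norm x = 1"
    "card (quat_frame I J) = 4" "independent (quat_frame I J)"
proof -
  note m = oct_sphere_mult[OF assms]
  have e: "orthogonal (oct_e 0) x" if "x \<in> oct_sphere" for x
    using that by (simp add: oct_sphere_iff orthogonal_def oct_Re_inner inner_commute)
  show n: "norm x = 1" if "x \<in> quat_frame I J" for x
    using that m(1) assms by (auto simp: quat_frame_def oct_sphere_iff)
  show p: "pairwise orthogonal (quat_frame I J)"
    using e[OF assms(1)] e[OF assms(2)] e[OF m(1)] m(2,3) assms(3)
    by (auto simp: quat_frame_def pairwise_insert orthogonal_commute)
  have ne: "a \<noteq> b" if "orthogonal a b" "norm a = 1" for a b :: octonion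
    using that by (auto simp: orthogonal_def norm_eq_1)
  have "oct_e 0 \<noteq> I" "oct_e 0 \<noteq> J" "oct_e 0 \<noteq> I \<odot> J"
    using ne[OF e] assms(1,2) m(1) by auto
  moreover have "I \<noteq> J" "I \<noteq> I \<odot> J" "J \<noteq> I \<odot> J"
    using ne assms m(2,3) by (auto simp only: oct_sphere_iff)
  ultimately show "card (quat_frame I J) = 4"
    by (simp add: quat_frame_def)
  have "0 \<notin> quat_frame I J" using n by force
  then show "independent (quat_frame I J)"
    using p pairwise_orthogonal_independent by blast
qed

text \<open>Products of two frame elements are frame elements up to sign, and bilinearity extends
  closure to the span. Conversely every subalgebra containing I and J contains the frame.\<close>

lemma quat_slice_eq_span:
  assumes "(I, J) \<in> oct_orth_pairs"
  shows "quat_slice (I, J) = span (quat_frame I J)" "oct_subalgebra (quat_slice (I, J))"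
proof -
  have *: "I \<in> oct_sphere" "J \<in> oct_sphere" "orthogonal I J"
    using assms by (auto simp: oct_orth_pairs_def)
  note m = oct_sphere_mult[OF *]
  let ?F = "quat_frame I J"
  have JJ: "J \<odot> J = - oct_e 0" "(I \<odot> J) \<odot> (I \<odot> J) = - oct_e 0"
    using oct_sphere_square[OF *(2), of "oct_e 0"] oct_sphere_square[OF m(1), of "oct_e 0"] by auto
  have in_span: "oct_e 0 \<in> span ?F" "I \<in> span ?F" "J \<in> span ?F" "I \<odot> J \<in> span ?F"
    by (auto simp: quat_frame_def intro: span_base)
  have quat_frameE: "(x = oct_e 0 \<Longrightarrow> R) \<Longrightarrow> (x = I \<Longrightarrow> R) \<Longrightarrow> (x = J \<Longrightarrow> R) \<Longrightarrow> (x = I \<odot> J \<Longrightarrow> R) \<Longrightarrow> R"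
    if "x \<in> ?F" for x R
    using that by (auto simp: quat_frame_def)
  have prod: "x \<odot> y \<in> span ?F" if "x \<in> ?F" "y \<in> ?F" for x y
    using that by (elim quat_frameE) (simp_all add: m(4-9) JJ in_span span_neg)
  have left: "x \<odot> y \<in> span ?F" if "x \<in> ?F" "y \<in> span ?F" for x y
    using that(2)
  proof (induction rule: span_induct_alt)
    case (step c a b)
    show ?case
      using span_add[OF span_scale[OF prod[OF that(1) step(1)]] step(2)]
      by (simp only: oct_mult.add_right oct_mult.scaleR_right)
  qed (simp add: span_zero oct_mult.zero_left oct_mult.zero_right)
  have closed: "x \<odot> y \<in> span ?F" if "x \<in> span ?F" "y \<in> span ?F" for x y
    using that(1)
  proof (induction rule: span_induct_alt)
    case (step c a b)
    show ?case
      using span_add[OF span_scale[OF left[OF step(1) that(2)]] step(2)]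
      by (simp only: oct_mult.add_left oct_mult.scaleR_left)
  qed (simp add: span_zero oct_mult.zero_left oct_mult.zero_right)
  have sub: "oct_subalgebra (span ?F)"
    using closed in_span(1) by (simp add: oct_subalgebra_def)
  show eq: "quat_slice (I, J) = span ?F"
    unfolding quat_slice_def prod.case
  proof (rule hull_unique)
    show "oct_subalgebra (span ?F)" by (rule sub)
    show "{I, J} \<subseteq> span ?F" by (auto simp: quat_frame_def intro: span_base)
    fix A assume "{I, J} \<subseteq> A" "oct_subalgebra A"
    then show "span ?F \<subseteq> A"
      by (intro span_minimal) (auto simp: oct_subalgebra_def quat_frame_def)
  qed
  show "oct_subalgebra (quat_slice (I, J))"
    unfolding eq by (rule sub)
qed

lemma quat_slice_properties:
  assumes "P \<in> oct_orth_pairs"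
  shows "subspace (quat_slice P)" "oct_e 0 \<in> quat_slice P" "dim (quat_slice P) = 4"
    "\<And>x y. x \<in> quat_slice P \<Longrightarrow> y \<in> quat_slice P \<Longrightarrow> x \<odot> y \<in> quat_slice P"
    "quat_slice P \<inter> oct_sphere \<noteq> {}"
proof -
  obtain I J where P: "P = (I, J)" and IJ: "(I, J) \<in> oct_orth_pairs"
    using assms by (cases P) auto
  note eq = quat_slice_eq_span[OF IJ, folded P]
  show "subspace (quat_slice P)" "oct_e 0 \<in> quat_slice P"
    "\<And>x y. x \<in> quat_slice P \<Longrightarrow> y \<in> quat_slice P \<Longrightarrow> x \<odot> y \<in> quat_slice P"
    using eq(2) by (auto simp: oct_subalgebra_def)
  have *: "I \<in> oct_sphere" "J \<in> oct_sphere" "orthogonal I J"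
    using IJ by (auto simp: oct_orth_pairs_def)
  show "dim (quat_slice P) = 4"
    unfolding eq(1) using quat_frame_orthonormal[OF *] by (metis dim_span_eq_card_independent)
  have "I \<in> quat_slice P" unfolding eq(1) by (rule span_base) (simp add: quat_frame_def)
  then show "quat_slice P \<inter> oct_sphere \<noteq> {}" using * by blast
qed

text \<open>Dimension above 2 leaves room for a vector of H orthogonal to both
  \<open>oct_e 0\<close> and K; orthogonality to \<open>oct_e 0\<close> makes it imaginary.\<close>

lemma exists_orthogonal_in_sphere:
  assumes H: "subspace H" "oct_e 0 \<in> H" "dim H > 2" and K: "K \<in> H"
  obtains J where "J \<in> H" "J \<in> oct_sphere" "orthogonal K J"
proof -
  have "dim (span {oct_e 0, K}) \<le> card {oct_e 0, K}"
    by (rule dim_le_card) auto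
  also have "\<dots> \<le> 2" by (simp add: card_insert_if)
  finally have "dim (span {oct_e 0, K}) < dim H" using H by simp
  moreover have "span {oct_e 0, K} \<subseteq> H"
    using K H by (intro span_minimal) auto
  ultimately have "span {oct_e 0, K} \<subset> span H"
    using span_eq_iff[of H] H(1) by (metis less_irrefl psubsetI)
  then obtain x where x: "x \<noteq> 0" "x \<in> span H" "\<And>y. y \<in> span {oct_e 0, K} \<Longrightarrow> orthogonal x y"
    using orthogonal_to_subspace_exists_gen by blast
  have xH: "x \<in> H" using x(2) span_minimal[OF subset_refl H(1)] by blast
  have xo: "x \<bullet> oct_e 0 = 0" "x \<bullet> K = 0"
    using x(3)[of "oct_e 0"] x(3)[of K] by (auto simp: orthogonal_def intro: span_base)
  have "x /\<^sub>R norm x \<in> H" "x /\<^sub>R norm x \<in> oct_sphere" "orthogonal K (x /\<^sub>R norm x)"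
    using xH H(1) x(1) xo
    by (auto simp: oct_sphere_iff orthogonal_def subspace_scale oct_Re_inner inner_commute)
  then show ?thesis by (rule that)
qed

text \<open>Any imaginary unit K of the slice can start a frame. At a point a + bK the frame then
  consists of the two directions of the half-plane through K and two directions tangent to the
  sphere of units.\<close>

lemma quat_slice_frame:
  assumes P: "P \<in> oct_orth_pairs" and K: "K \<in> quat_slice P" "K \<in> oct_sphere"
  obtains J where "J \<in> oct_sphere" "orthogonal K J" "span (quat_frame K J) = quat_slice P"
proof -
  note H = quat_slice_properties[OF P]
  obtain J where J: "J \<in> quat_slice P" "J \<in> oct_sphere" "orthogonal K J"
    using exists_orthogonal_in_sphere[OF H(1,2) _ K(1)] H(3) by auto
  note F = quat_frame_orthonormal[OF K(2) J(2,3)]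
  have "span (quat_frame K J) \<subseteq> quat_slice P"
    using H J K by (intro span_minimal) (auto simp: quat_frame_def)
  moreover have "dim (span (quat_frame K J)) = 4"
    using F by (metis dim_span_eq_card_independent)
  ultimately have "span (quat_frame K J) = quat_slice P"
    using H(1,3) by (intro subspace_dim_equal) auto
  then show ?thesis using that J by blast
qed

section \<open>Hopf's boundary point lemma\<close>

text \<open>If D > 0, then g' is positive just to the right of its zero at 0, so g increases there.
  Differentiability of g' at the single point 0 is enough.\<close>

lemma second_derivative_nonpos_at_max:
  fixes g g' :: "real \<Rightarrow> real"
  assumes d: "\<forall>\<^sub>F t in nhds 0. (g has_real_derivative g' t) (at t)"
    and d2: "(g' has_real_derivative D) (at 0)"
    and max: "\<forall>\<^sub>F t in nhds 0. g t \<le> g 0"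
  shows "D \<le> 0"
proof (rule ccontr)
  assume "\<not> D \<le> 0"
  then have "D > 0" by simp
  obtain e where e: "e > 0" "\<And>t. \<bar>t\<bar> < e \<Longrightarrow> (g has_real_derivative g' t) (at t)" "\<And>t. \<bar>t\<bar> < e \<Longrightarrow> g t \<le> g 0"
    using eventually_conj[OF d max] unfolding eventually_nhds_metric by (auto simp: dist_real_def)
  have g0: "g' 0 = 0"
    using e by (intro DERIV_local_max[of g "g' 0" 0 e]) auto
  obtain r where r: "r > 0" "\<And>h. 0 < h \<Longrightarrow> h < r \<Longrightarrow> g' 0 < g' (0 + h)"
    using DERIV_pos_inc_right[OF d2 \<open>D > 0\<close>] by auto
  define t where "t = min e r / 2"
  have t: "0 < t" "t < e" "t < r" using e r by (auto simp: t_def min_def)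
  have "g 0 < g t"
  proof (rule DERIV_pos_imp_increasing_open[OF t(1)])
    fix x assume "0 < x" "x < t"
    then show "\<exists>y. (g has_real_derivative y) (at x) \<and> 0 < y"
      using e(2)[of x] r(2)[of x] t g0 by auto
  next
    show "continuous_on {0..t} g"
      using t e(2) by (intro continuous_at_imp_continuous_on ballI DERIV_isCont[OF e(2)]) auto
  qed
  with e(3)[of t] t show False by auto
qed

text \<open>Harmonicity is only needed in this weak pointwise form; summing over both directions of each
  line removes the odd terms, whose second derivatives would otherwise have to be computed.\<close>

definition lines_sum :: "'a::real_vector set \<Rightarrow> ('a \<Rightarrow> real) \<Rightarrow> 'a \<Rightarrow> real \<Rightarrow> real" where
  "lines_sum B \<phi> z t = (\<Sum>J\<in>B. \<phi> (z + t *\<^sub>R J) + \<phi> (z - t *\<^sub>R J))"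

text \<open>The orthonormal basis is existentially quantified so that every point may use the frame
  adapted to its own direction. For smooth functions the vanishing derivative of \<open>G'\<close>
  at 0 is twice the Laplacian along H.\<close>

definition harmonic_at :: "'a::euclidean_space set \<Rightarrow> ('a \<Rightarrow> real) \<Rightarrow> 'a \<Rightarrow> bool" where
  "harmonic_at H \<phi> z \<longleftrightarrow> (\<exists>B G'. pairwise orthogonal B \<and> (\<forall>x\<in>B. norm x = 1) \<and> span B = H \<and>
     (\<forall>\<^sub>F t in nhds 0. (lines_sum B \<phi> z has_real_derivative G' t) (at t)) \<and>
     (G' has_real_derivative 0) (at 0))"

lemma barrier_line_derivatives:
  fixes w J :: "'a::real_inner"
  assumes "norm J = 1"
  shows "((\<lambda>t. exp (- A * (norm (w + t *\<^sub>R J))\<^sup>2)) has_real_derivative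
       exp (- A * (norm (w + t *\<^sub>R J))\<^sup>2) * (- A * (2 * (w \<bullet> J) + 2 * t))) (at t)"
    and "((\<lambda>t. exp (- A * (norm (w + t *\<^sub>R J))\<^sup>2) * (- A * (2 * (w \<bullet> J) + 2 * t)))
       has_real_derivative exp (- A * (norm w)\<^sup>2) * (4 * A\<^sup>2 * (w \<bullet> J)\<^sup>2 - 2 * A)) (at 0)"
proof -
  have J: "J \<bullet> J = 1" using assms by (simp add: norm_eq_1)
  have n: "(norm (w + t *\<^sub>R J))\<^sup>2 = (norm w)\<^sup>2 + 2 * t * (w \<bullet> J) + t\<^sup>2" for t
    unfolding power2_norm_eq_inner
    by (simp add: inner_add_left inner_add_right J inner_commute[of J w] power2_eq_square distrib_left)
  show 1: "((\<lambda>t. exp (- A * (norm (w + t *\<^sub>R J))\<^sup>2)) has_real_derivative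
       exp (- A * (norm (w + t *\<^sub>R J))\<^sup>2) * (- A * (2 * (w \<bullet> J) + 2 * t))) (at t)" for t
    unfolding n by (auto intro!: derivative_eq_intros)
  show "((\<lambda>t. exp (- A * (norm (w + t *\<^sub>R J))\<^sup>2) * (- A * (2 * (w \<bullet> J) + 2 * t)))
       has_real_derivative exp (- A * (norm w)\<^sup>2) * (4 * A\<^sup>2 * (w \<bullet> J)\<^sup>2 - 2 * A)) (at 0)"
    by (rule derivative_eq_intros 1 refl)+ (simp add: algebra_simps power2_eq_square)
qed

text \<open>The barrier \<open>exp (- A |x - q|\<^sup>2)\<close> is strictly subharmonic where
  \<open>2 A |x - q|\<^sup>2 > dim H\<close>, so adding it excludes interior maxima.\<close>

lemma harmonic_barrier_no_max:
  fixes z q :: "'a::euclidean_space"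
  assumes harm: "harmonic_at H \<phi> z" and "z \<in> H" "q \<in> H" "subspace H"
    and "A > 0" "\<epsilon> > 0" and big: "2 * A * (norm (z - q))\<^sup>2 > real (dim H)"
    and max: "\<forall>\<^sub>F x in nhds z. x \<in> H \<longrightarrow>
      \<phi> x + \<epsilon> * exp (- A * (norm (x - q))\<^sup>2) \<le> \<phi> z + \<epsilon> * exp (- A * (norm (z - q))\<^sup>2)"
  shows False
proof -
  obtain B G' where B: "pairwise orthogonal B" "\<And>x. x \<in> B \<Longrightarrow> norm x = 1" "span B = H"
    and G1: "\<forall>\<^sub>F t in nhds 0. (lines_sum B \<phi> z has_real_derivative G' t) (at t)"
    and G2: "(G' has_real_derivative 0) (at 0)"
    using harm unfolding harmonic_at_def by blast
  have "0 \<notin> B" using B(2) by force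
  then have ind: "independent B" using B(1) pairwise_orthogonal_independent by blast
  then have fin: "finite B" by (rule independent_imp_finite)
  have card: "card B = dim H" using ind B(3) by (metis dim_span_eq_card_independent)
  define w where "w = z - q"
  have wH: "w \<in> H" using assms(2-4) by (auto simp: w_def subspace_diff)
  define E where "E = (\<lambda>J t. exp (- A * (norm (w + t *\<^sub>R J))\<^sup>2))"
  define E' where "E' = (\<lambda>J t. exp (- A * (norm (w + t *\<^sub>R J))\<^sup>2) * (- A * (2 * (w \<bullet> J) + 2 * t)))"
  have E: "(E J has_real_derivative E' J t) (at t)" if "norm J = 1" for J t
    unfolding E_def E'_def by (rule barrier_line_derivatives(1)[OF that])
  have E2: "(E' J has_real_derivative exp (- A * (norm w)\<^sup>2) * (4 * A\<^sup>2 * (w \<bullet> J)\<^sup>2 - 2 * A)) (at 0)"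
    if "norm J = 1" for J
    unfolding E'_def by (rule barrier_line_derivatives(2)[OF that])
  define \<psi> where "\<psi> = (\<lambda>x. \<phi> x + \<epsilon> * exp (- A * (norm (x - q))\<^sup>2))"
  have eq: "lines_sum B \<psi> z t = lines_sum B \<phi> z t + \<epsilon> * (\<Sum>J\<in>B. E J t + E (- J) t)" for t
    unfolding lines_sum_def \<psi>_def E_def w_def sum_distrib_left sum.distrib[symmetric]
    by (intro sum.cong refl) (simp add: algebra_simps)
  let ?G = "\<lambda>t. G' t + \<epsilon> * (\<Sum>J\<in>B. E' J t + E' (- J) t)"
  let ?D = "\<epsilon> * (\<Sum>J\<in>B. exp (- A * (norm w)\<^sup>2) * (4 * A\<^sup>2 * (w \<bullet> J)\<^sup>2 - 2 * A) + exp (- A * (norm w)\<^sup>2) * (4 * A\<^sup>2 * (w \<bullet> (- J))\<^sup>2 - 2 * A))"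
  have "0 + ?D \<le> 0"
  proof (rule second_derivative_nonpos_at_max)
    show "\<forall>\<^sub>F t in nhds 0. (lines_sum B \<psi> z has_real_derivative ?G t) (at t)"
      using G1
    proof eventually_elim
      case (elim t)
      show ?case unfolding eq
        by (intro DERIV_add DERIV_cmult DERIV_sum elim E) (auto simp: B(2))
    qed
    show "(?G has_real_derivative 0 + ?D) (at 0)"
      by (intro DERIV_add DERIV_cmult DERIV_sum G2 E2) (auto simp: B(2))
    have "\<forall>\<^sub>F t in nhds 0. \<forall>J\<in>B. \<psi> (z + t *\<^sub>R J) \<le> \<psi> z \<and> \<psi> (z - t *\<^sub>R J) \<le> \<psi> z"
    proof (intro eventually_ball_finite fin ballI eventually_conj)
      fix J assume "J \<in> B"
      then have J: "J \<in> H" using B(3) span_base by blast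
      have *: "\<forall>\<^sub>F t in nhds 0. \<psi> (z + t *\<^sub>R K) \<le> \<psi> z" if "K \<in> H" for K
      proof -
        have "((\<lambda>t. z + t *\<^sub>R K) \<longlongrightarrow> z + 0 *\<^sub>R K) (nhds 0)"
          by (intro tendsto_intros filterlim_ident)
        then have "filterlim (\<lambda>t. z + t *\<^sub>R K) (nhds z) (nhds 0)" by simp
        then have "\<forall>\<^sub>F t in nhds 0. z + t *\<^sub>R K \<in> H \<longrightarrow> \<psi> (z + t *\<^sub>R K) \<le> \<psi> z"
          unfolding \<psi>_def by (rule eventually_compose_filterlim[OF max])
        then show ?thesis
          using assms(2,4) that by (simp add: subspace_add subspace_scale)
      qed
      show "\<forall>\<^sub>F t in nhds 0. \<psi> (z + t *\<^sub>R J) \<le> \<psi> z" by (rule *[OF J])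
      show "\<forall>\<^sub>F t in nhds 0. \<psi> (z - t *\<^sub>R J) \<le> \<psi> z"
        using *[of "- J"] J assms(4) by (simp add: subspace_neg)
    qed
    then show "\<forall>\<^sub>F t in nhds 0. lines_sum B \<psi> z t \<le> lines_sum B \<psi> z 0"
    proof eventually_elim
      case (elim t)
      then show ?case unfolding lines_sum_def by (intro sum_mono add_mono) auto
    qed
  qed
  \<comment> \<open>Parseval's identity collects the directional second derivatives into the
    Laplacian of the barrier, \<open>4 * A\<^sup>2 * (norm w)\<^sup>2 - 2 * A * dim H\<close> times
    the exponential; the outer factor 2 comes from using both J and -J.\<close>
  moreover have "(\<Sum>J\<in>B. (w \<bullet> J)\<^sup>2) = (norm w)\<^sup>2"
  proof -
    have "w \<bullet> w = w \<bullet> (\<Sum>J\<in>B. (w \<bullet> J) *\<^sub>R J)"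
      using orthonormal_basis_expand[of B w] B wH fin by simp
    then show ?thesis
      by (simp add: inner_sum_right power2_eq_square flip: power2_norm_eq_inner)
  qed
  then have "?D = \<epsilon> * (2 * exp (- A * (norm w)\<^sup>2) * (4 * A\<^sup>2 * (norm w)\<^sup>2 - 2 * A * dim H))"
    by (simp add: sum.distrib sum_subtractf card flip: sum_distrib_left)
  moreover have "4 * A\<^sup>2 * (norm w)\<^sup>2 - 2 * A * dim H = 2 * A * (2 * A * (norm (z - q))\<^sup>2 - dim H)"
    by (simp add: w_def algebra_simps power2_eq_square)
  ultimately have nonpos: "\<epsilon> * (2 * exp (- A * (norm w)\<^sup>2) * (2 * A * (2 * A * (norm (z - q))\<^sup>2 - dim H))) \<le> 0"
    by (simp only: add_0)
  have pos: "0 < \<epsilon> * (2 * exp (- A * (norm w)\<^sup>2) * (2 * A * (2 * A * (norm (z - q))\<^sup>2 - dim H)))"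
    using assms(5,6) big by (intro mult_pos_pos) auto
  show False by (rule notE[OF leD[OF nonpos] pos])
qed

text \<open>Adding a small multiple of the barrier to \<phi> keeps y a maximum over the annulus
  between radii r / 2 and r. Along the inward radius the derivative of \<phi> at y is 0, as y is a
  local maximum on H, while the barrier strictly increases: a contradiction.\<close>

lemma hopf_boundary_point:
  fixes q y :: "'a::euclidean_space"
  assumes H: "subspace H" "q \<in> H" "y \<in> H" and r: "norm (y - q) = r" "r > 0"
    and cont: "continuous_on (H \<inter> cball q r) \<phi>"
    and harm: "\<And>x. x \<in> H \<Longrightarrow> norm (x - q) < r \<Longrightarrow> harmonic_at H \<phi> x"
    and less: "\<And>x. x \<in> H \<Longrightarrow> norm (x - q) < r \<Longrightarrow> \<phi> x < M"
    and le: "\<And>x. x \<in> H \<Longrightarrow> norm (x - q) = r \<Longrightarrow> \<phi> x \<le> M"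
    and y: "\<phi> y = M" "(\<phi> has_derivative \<phi>') (at y)"
    and max: "\<forall>\<^sub>F x in nhds y. x \<in> H \<longrightarrow> \<phi> x \<le> M"
  shows False
proof -
  \<comment> \<open>Chosen so that 2 A |x - q|^2 is at least dim H + 1 when |x - q| is at least r /
    2, which makes the barrier strictly subharmonic on the annulus.\<close>
  define A where "A = 2 * (real (dim H) + 1) / r\<^sup>2"
  have A: "A > 0" using r by (simp add: A_def)
  let ?E = "\<lambda>x. exp (- A * (norm (x - q))\<^sup>2)"
  have contE: "continuous_on S ?E" for S by (intro continuous_intros)
  define S where "S = H \<inter> sphere q (r / 2)"
  have S: "compact S" unfolding S_def
    by (intro closed_Int_compact closed_subspace H compact_sphere)
  have "q + (1 / 2) *\<^sub>R (y - q) \<in> S"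
    using H r by (auto simp: S_def dist_norm intro!: subspace_add subspace_scale subspace_diff)
  then have "S \<noteq> {}" by blast
  moreover have "continuous_on S \<phi>"
    using r(2) by (intro continuous_on_subset[OF cont]) (auto simp: S_def)
  ultimately obtain s where s: "s \<in> S" "\<And>x. x \<in> S \<Longrightarrow> \<phi> x \<le> \<phi> s"
    using continuous_attains_sup[OF S] by blast
  \<comment> \<open>The gap between M and the maximum of \<phi> on the inner sphere. As the barrier
    is at most 1, the perturbed function stays at most M on that sphere.\<close>
  define \<epsilon> where "\<epsilon> = M - \<phi> s"
  have \<epsilon>: "\<epsilon> > 0"
    using less[of s] s(1) r by (simp add: \<epsilon>_def S_def dist_norm norm_minus_commute)
  define \<psi> where "\<psi> = (\<lambda>x. \<phi> x + \<epsilon> * ?E x)"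
  define R where "R = (H \<inter> cball q r) - ball q (r / 2)"
  have R: "x \<in> R \<longleftrightarrow> x \<in> H \<and> r / 2 \<le> norm (x - q) \<and> norm (x - q) \<le> r" for x
    by (auto simp: R_def dist_norm norm_minus_commute)
  have "compact R" unfolding R_def
    by (intro compact_diff closed_Int_compact closed_subspace H) auto
  moreover have "y \<in> R" using H r by (simp add: R)
  moreover have "continuous_on R \<psi>" unfolding \<psi>_def
    by (intro continuous_intros continuous_on_subset[OF cont]) (auto simp: R_def)
  ultimately obtain z where z: "z \<in> R" "\<And>x. x \<in> R \<Longrightarrow> \<psi> x \<le> \<psi> z"
    using continuous_attains_sup[of R \<psi>] by blast
  \<comment> \<open>An interior maximum is excluded by subharmonicity, the inner sphere by the
    choice of \<epsilon>; on the outer sphere the barrier is constant and \<phi> is at most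
    M.\<close>
  have bound: "\<psi> z \<le> \<psi> y"
  proof (cases "r / 2 < norm (z - q) \<and> norm (z - q) < r")
    case True
    have "open {x. r / 2 < norm (x - q) \<and> norm (x - q) < r}"
      by (intro open_Collect_conj open_Collect_less continuous_intros)
    then have "\<forall>\<^sub>F x in nhds z. x \<in> {x. r / 2 < norm (x - q) \<and> norm (x - q) < r}"
      using True by (intro eventually_nhds_in_open) auto
    then have ev: "\<forall>\<^sub>F x in nhds z. x \<in> H \<longrightarrow> \<phi> x + \<epsilon> * ?E x \<le> \<phi> z + \<epsilon> * ?E z"
      by eventually_elim (use z(2) in \<open>auto simp: R \<psi>_def\<close>)
    have "(r / 2)\<^sup>2 < (norm (z - q))\<^sup>2"
      using True r by (intro power_strict_mono) auto
    then have "A * (r / 2)\<^sup>2 < A * (norm (z - q))\<^sup>2" using A by simp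
    moreover have "A * (r / 2)\<^sup>2 = (real (dim H) + 1) / 2"
      using r by (simp add: A_def field_simps power2_eq_square)
    ultimately have "real (dim H) < 2 * A * (norm (z - q))\<^sup>2" by simp
    from harmonic_barrier_no_max[OF harm _ H(2,1) A \<epsilon> this ev] z(1) True
    show ?thesis by (auto simp: R)
  next
    case False
    then consider "norm (z - q) = r / 2" | "norm (z - q) = r" using z(1) by (force simp: R)
    then show ?thesis
    proof cases
      case 1
      have "\<phi> z \<le> \<phi> s" using 1 z(1) by (intro s) (auto simp: S_def R dist_norm norm_minus_commute)
      moreover have "\<epsilon> * ?E z \<le> \<epsilon> * 1" using \<epsilon> A by (intro mult_left_mono) auto
      moreover have "0 \<le> \<epsilon> * ?E y" using \<epsilon> by simp
      moreover have "\<phi> s + \<epsilon> = \<phi> y" by (simp add: \<epsilon>_def y(1))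
      ultimately show ?thesis unfolding \<psi>_def by linarith
    next
      case 2
      then show ?thesis using le[of z] z(1) y(1) r by (auto simp: \<psi>_def R)
    qed
  qed
  let ?c = "\<lambda>t. y + t *\<^sub>R (q - y)"
  have c: "(?c has_derivative (\<lambda>t. t *\<^sub>R (q - y))) (at 0)"
    by (auto intro!: derivative_eq_intros)
  have "((\<lambda>t. \<phi> (?c t)) has_derivative (\<lambda>t. \<phi>' (t *\<^sub>R (q - y)))) (at 0)"
    using diff_chain_at[OF c, of \<phi> \<phi>'] y(2) by (simp add: o_def)
  moreover have "\<phi>' (t *\<^sub>R (q - y)) = \<phi>' (q - y) * t" for t
    using has_derivative_linear[OF y(2)] by (simp add: linear_cmul)
  ultimately have d\<phi>: "((\<lambda>t. \<phi> (?c t)) has_real_derivative \<phi>' (q - y)) (at 0)"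
    by (simp add: has_field_derivative_def)
  have "filterlim ?c (nhds (?c 0)) (nhds 0)"
    by (intro tendsto_intros filterlim_ident)
  then have "filterlim ?c (nhds y) (nhds 0)" by simp
  from eventually_compose_filterlim[OF max this]
  have "\<forall>\<^sub>F t in nhds 0. \<phi> (?c t) \<le> M"
    using H by (simp add: subspace_add subspace_scale subspace_diff)
  then obtain d where d: "d > 0" "\<And>t. \<bar>t\<bar> < d \<Longrightarrow> \<phi> (?c t) \<le> M"
    unfolding eventually_nhds_metric by (auto simp: dist_real_def)
  \<comment> \<open>The curve runs through H on both sides of y, so the two-sided first-order
    condition applies.\<close>
  have "\<phi>' (q - y) = 0"
    by (rule DERIV_local_max[OF d\<phi> d(1)]) (use d y(1) in auto)
  with d\<phi> have d\<phi>: "((\<lambda>t. \<phi> (?c t)) has_real_derivative 0) (at 0)" by simp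
  have nc: "norm (?c t - q) = \<bar>1 - t\<bar> * r" for t
  proof -
    have "?c t - q = (1 - t) *\<^sub>R (y - q)" by (simp add: algebra_simps)
    then show ?thesis using r by simp
  qed
  have "((\<lambda>t. \<phi> (?c t) + \<epsilon> * exp (- A * ((1 - t) * r)\<^sup>2)) has_real_derivative
      0 + \<epsilon> * (exp (- A * r\<^sup>2) * (2 * A * r\<^sup>2))) (at 0)"
    by (intro DERIV_add d\<phi>) (auto intro!: derivative_eq_intros simp: power2_eq_square)
  moreover have "\<psi> (?c t) = \<phi> (?c t) + \<epsilon> * exp (- A * ((1 - t) * r)\<^sup>2)" for t
    unfolding \<psi>_def nc by (simp add: power_mult_distrib)
  ultimately have d\<psi>: "((\<lambda>t. \<psi> (?c t)) has_real_derivative \<epsilon> * (exp (- A * r\<^sup>2) * (2 * A * r\<^sup>2))) (at 0)"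
    by simp
  have "\<epsilon> * (exp (- A * r\<^sup>2) * (2 * A * r\<^sup>2)) > 0" using \<epsilon> A r by simp
  from DERIV_pos_inc_right[OF d\<psi> this] obtain e where
    e: "e > 0" "\<And>h. 0 < h \<Longrightarrow> h < e \<Longrightarrow> \<psi> y < \<psi> (?c h)" by auto
  define t where "t = min (1 / 2) (e / 2)"
  have t: "0 < t" "t \<le> 1 / 2" "t < e" using e(1) by (auto simp: t_def)
  have "?c t \<in> R"
    unfolding R nc using t r H
    by (auto simp: subspace_add subspace_scale subspace_diff)
  then show False using z(2)[of "?c t"] bound e(2)[OF t(1,3)] by simp
qed

section \<open>The axially symmetric Fueter system\<close>

text \<open>The Poincare lemma on a convex set. Closedness is encoded by the shared coefficient
  \<open>p2\<close>, and the potential is the integral of the form along segments from a base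
  point.\<close>

lemma closed_form_has_potential:
  fixes p q p1 p2 q2 :: "complex \<Rightarrow> real"
  assumes D: "open D" "convex D"
    and dp: "\<And>z. z \<in> D \<Longrightarrow> (p has_derivative (\<lambda>h. p1 z * Re h + p2 z * Im h)) (at z)"
    and dq: "\<And>z. z \<in> D \<Longrightarrow> (q has_derivative (\<lambda>h. p2 z * Re h + q2 z * Im h)) (at z)"
    and cont: "continuous_on D p1" "continuous_on D p2" "continuous_on D q2"
  obtains S where "\<And>z. z \<in> D \<Longrightarrow> (S has_derivative (\<lambda>h. p z * Re h + q z * Im h)) (at z)"
proof (cases "D = {}")
  case False
  then obtain z0 where z0: "z0 \<in> D" by blast
  define l where "l = (\<lambda>z t. z0 + t *\<^sub>R (z - z0))"
  have lD: "l z t \<in> D" if "z \<in> D" "t \<in> {0..1}" for z t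
  proof -
    have "l z t = (1 - t) *\<^sub>R z0 + t *\<^sub>R z" by (simp add: l_def algebra_simps)
    then show ?thesis using convexD_alt[OF D(2) z0 that(1), of t] that(2) by simp
  qed
  define f where "f = (\<lambda>z t. p (l z t) * Re (z - z0) + q (l z t) * Im (z - z0))"
  \<comment> \<open>\<open>P\<close> and \<open>Q\<close> are the partial derivatives of the
    integrand \<open>f\<close> in z and, by closedness, also the t-derivatives of
    \<open>t * p (l z t)\<close> and \<open>t * q (l z t)\<close>. Hence their integrals over [0, 1]
    are \<open>p z\<close> and \<open>q z\<close>.\<close>
  define P where "P = (\<lambda>z t. p (l z t) + t * (p1 (l z t) * Re (z - z0) + p2 (l z t) * Im (z - z0)))"
  define Q where "Q = (\<lambda>z t. q (l z t) + t * (p2 (l z t) * Re (z - z0) + q2 (l z t) * Im (z - z0)))"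
  define R I where "R = Blinfun Re" and "I = Blinfun Im"
  have RI: "blinfun_apply R = Re" "blinfun_apply I = Im"
    by (simp_all add: R_def I_def bounded_linear_Blinfun_apply bounded_linear_Re bounded_linear_Im)
  define f' where "f' = (\<lambda>z t. P z t *\<^sub>R R + Q z t *\<^sub>R I)"
  have contpq: "continuous_on D p" "continuous_on D q"
    using dp dq by (auto intro!: continuous_at_imp_continuous_on has_derivative_continuous)
  have dl: "((\<lambda>z. l z t) has_derivative (\<lambda>h. t *\<^sub>R h)) (at z within U)" for z t U
    unfolding l_def by (auto intro!: derivative_eq_intros)
  have dl2: "((\<lambda>t. l z t) has_derivative (\<lambda>s. s *\<^sub>R (z - z0))) (at t within U)" for z t U
    unfolding l_def by (auto intro!: derivative_eq_intros)
  have deriv: "((\<lambda>z. integral (cbox 0 1) (f z)) has_derivative blinfun_apply (integral (cbox 0 1) (f' z)))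
      (at z within D)" if "z \<in> D" for z
  proof (rule leibniz_rule[OF _ _ _ that D(2)])
    fix x and t :: real assume x: "x \<in> D" and "t \<in> cbox 0 1"
    then have l: "l x t \<in> D" using lD by simp
    show "((\<lambda>x. f x t) has_derivative blinfun_apply (f' x t)) (at x within D)"
      unfolding f_def
      by (rule derivative_eq_intros has_derivative_compose[OF dl dp[OF l]]
          has_derivative_compose[OF dl dq[OF l]] refl)+
        (simp only: f'_def RI blinfun.add_left blinfun.scaleR_left fun_eq_iff, simp add: P_def Q_def algebra_simps)
  next
    fix x assume x: "x \<in> D"
    have "continuous_on (cbox 0 1) (l x)" unfolding l_def by (intro continuous_intros)
    then show "f x integrable_on cbox 0 1"
      unfolding f_def using lD[OF x]
      by (intro integrable_continuous continuous_intros continuous_on_compose2[OF contpq(1)]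
          continuous_on_compose2[OF contpq(2)]) auto
  next
    have cl: "continuous_on (D \<times> cbox 0 1) (\<lambda>x. l (fst x) (snd x))"
      unfolding l_def by (intro continuous_intros)
    have "(\<lambda>x. l (fst x) (snd x)) ` (D \<times> cbox 0 1) \<subseteq> D" using lD by auto
    note c = continuous_on_compose2[OF _ cl this]
    show "continuous_on (D \<times> cbox 0 1) (\<lambda>(x, t). f' x t)"
      unfolding f'_def P_def Q_def split_beta
      by (intro continuous_intros c cont contpq)
  qed
  have int: "integral (cbox 0 1) (f' z) = p z *\<^sub>R R + q z *\<^sub>R I" if z: "z \<in> D" for z
  proof (rule integral_unique)
    have l1: "l z 1 = z" by (simp add: l_def)
    have "(P z has_integral (1 * p (l z 1) - 0 * p (l z 0))) {0..1}"
    proof (rule fundamental_theorem_of_calculus)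
      fix t :: real assume "t \<in> {0..1}"
      then have l: "l z t \<in> D" using lD z by simp
      have "((\<lambda>t. t * p (l z t)) has_derivative (\<lambda>s. s * P z t)) (at t within {0..1})"
        by (rule derivative_eq_intros has_derivative_compose[OF dl2 dp[OF l]] refl)+
          (simp add: P_def algebra_simps fun_eq_iff)
      then show "((\<lambda>t. t * p (l z t)) has_vector_derivative P z t) (at t within {0..1})"
        by (simp add: has_vector_derivative_def)
    qed simp
    moreover have "(Q z has_integral (1 * q (l z 1) - 0 * q (l z 0))) {0..1}"
    proof (rule fundamental_theorem_of_calculus)
      fix t :: real assume "t \<in> {0..1}"
      then have l: "l z t \<in> D" using lD z by simp
      have "((\<lambda>t. t * q (l z t)) has_derivative (\<lambda>s. s * Q z t)) (at t within {0..1})"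
        by (rule derivative_eq_intros has_derivative_compose[OF dl2 dq[OF l]] refl)+
          (simp add: Q_def algebra_simps fun_eq_iff)
      then show "((\<lambda>t. t * q (l z t)) has_vector_derivative Q z t) (at t within {0..1})"
        by (simp add: has_vector_derivative_def)
    qed simp
    ultimately show "(f' z has_integral p z *\<^sub>R R + q z *\<^sub>R I) (cbox 0 1)"
      unfolding f'_def l1 by (intro has_integral_add has_integral_scaleR_left) auto
  qed
  show ?thesis
  proof (rule that)
    fix z assume z: "z \<in> D"
    show "((\<lambda>z. integral (cbox 0 1) (f z)) has_derivative (\<lambda>h. p z * Re h + q z * Im h)) (at z)"
      using deriv[OF z] unfolding int[OF z] at_within_open[OF z D(1)]
      by (rule back_subst[where P="\<lambda>g. (_ has_derivative g) _"])
        (simp add: fun_eq_iff RI blinfun.add_left blinfun.scaleR_left)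
  qed
qed (use that in auto)

text \<open>The equations for the components of an axially symmetric function \<open>a + I b\<close>; the suffixes
  \<open>1\<close> and \<open>2\<close> denote partial derivatives.\<close>

locale vekua =
  fixes D :: "complex set" and a b a1 a2 b1 b2 :: "complex \<Rightarrow> real"
  assumes open_D: "open D" and convex_D: "convex D" and D_pos: "\<And>z. z \<in> D \<Longrightarrow> Im z > 0"
    and da: "\<And>z. z \<in> D \<Longrightarrow> (a has_derivative (\<lambda>h. a1 z * Re h + a2 z * Im h)) (at z)"
    and db: "\<And>z. z \<in> D \<Longrightarrow> (b has_derivative (\<lambda>h. b1 z * Re h + b2 z * Im h)) (at z)"
    and cont: "continuous_on D a1" "continuous_on D a2" "continuous_on D b2"
    and sys1: "\<And>z. z \<in> D \<Longrightarrow> a1 z = b2 z + 2 * b z / Im z"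
    and sys2: "\<And>z. z \<in> D \<Longrightarrow> a2 z = - b1 z"
begin

text \<open>With dS = a dx - b dy, both equations of the system together say that the differentials
  of S - y b and y a satisfy the Cauchy-Riemann equations, where y is \<open>Im z\<close>.\<close>

lemma holomorphic_companion:
  obtains h where "\<And>z. z \<in> D \<Longrightarrow> (h has_field_derivative Complex (a z + Im z * a2 z) (Im z * a1 z)) (at z)"
    "\<And>z. z \<in> D \<Longrightarrow> Im (h z) = Im z * a z"
proof -
  obtain S where S: "\<And>z. z \<in> D \<Longrightarrow> (S has_derivative (\<lambda>h. a z * Re h + (- b z) * Im h)) (at z)"
  proof (rule closed_form_has_potential[OF open_D convex_D da])
    fix z assume z: "z \<in> D"
    show "((\<lambda>z. - b z) has_derivative (\<lambda>h. a2 z * Re h + (- b2 z) * Im h)) (at z)"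
      using has_derivative_minus[OF db[OF z]] sys2[OF z] by (simp add: algebra_simps)
  qed (use cont in \<open>auto intro!: continuous_intros\<close>)
  show ?thesis
  proof (rule that)
    fix z assume z: "z \<in> D"
    have yz: "Im z \<noteq> 0" using D_pos[OF z] by simp
    have P: "((\<lambda>z. S z - Im z * b z) has_derivative
        (\<lambda>d. (a z + Im z * a2 z) * Re d - Im z * a1 z * Im d)) (at z)"
      by (rule derivative_eq_intros S[OF z] db[OF z] refl)+
        (use yz in \<open>simp add: fun_eq_iff sys1[OF z] sys2[OF z] field_simps\<close>)
    have Q: "((\<lambda>z. Im z * a z) has_derivative
        (\<lambda>d. Im z * a1 z * Re d + (a z + Im z * a2 z) * Im d)) (at z)"
      by (rule derivative_eq_intros da[OF z] refl)+ (simp add: fun_eq_iff algebra_simps)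
    have "((\<lambda>z. of_real (S z - Im z * b z) + \<i> * of_real (Im z * a z)) has_derivative
        (\<lambda>d. of_real ((a z + Im z * a2 z) * Re d - Im z * a1 z * Im d)
          + \<i> * of_real (Im z * a1 z * Re d + (a z + Im z * a2 z) * Im d))) (at z)"
      by (intro has_derivative_add has_derivative_of_real has_derivative_mult_right P Q)
    also have "(\<lambda>z. of_real (S z - Im z * b z) + \<i> * of_real (Im z * a z)) =
        (\<lambda>z. Complex (S z - Im z * b z) (Im z * a z))"
      by (simp add: fun_eq_iff complex_eq_iff)
    also have "(\<lambda>d. of_real ((a z + Im z * a2 z) * Re d - Im z * a1 z * Im d)
          + \<i> * of_real (Im z * a1 z * Re d + (a z + Im z * a2 z) * Im d)) =
        (*) (Complex (a z + Im z * a2 z) (Im z * a1 z))"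
      by (simp add: fun_eq_iff complex_eq_iff)
    finally show "((\<lambda>z. Complex (S z - Im z * b z) (Im z * a z)) has_field_derivative
        Complex (a z + Im z * a2 z) (Im z * a1 z)) (at z)"
      by (simp add: has_field_derivative_def)
  qed simp
qed

text \<open>Both first partials of a can be read off from h': y a1 is its imaginary part and a + y
  a2 its real part. As h' is holomorphic they are differentiable, and complex linearity of its
  derivative gives equal mixed partials and the second-order equation.\<close>

lemma second_derivatives:
  assumes z: "z \<in> D"
  obtains a11 a12 a22 where
    "(a1 has_derivative (\<lambda>d. a11 * Re d + a12 * Im d)) (at z)"
    "(a2 has_derivative (\<lambda>d. a12 * Re d + a22 * Im d)) (at z)"
    "a11 + a22 + 2 * a2 z / Im z = 0"
proof -
  obtain h where h: "\<And>z. z \<in> D \<Longrightarrow> (h has_field_derivative Complex (a z + Im z * a2 z) (Im z * a1 z)) (at z)"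
    using holomorphic_companion by metis
  define h' where "h' = deriv h"
  have h': "h' z = Complex (a z + Im z * a2 z) (Im z * a1 z)" if "z \<in> D" for z
    unfolding h'_def by (rule DERIV_imp_deriv[OF h[OF that]])
  have "h holomorphic_on D"
    using h by (auto simp: holomorphic_on_def field_differentiable_def intro: has_field_derivative_at_within)
  then have "h' holomorphic_on D"
    unfolding h'_def using open_D by (rule holomorphic_deriv)
  then obtain c where "(h' has_field_derivative c) (at z)"
    using z open_D by (metis holomorphic_on_imp_differentiable_at field_differentiable_def)
  then have dh: "(h' has_derivative (\<lambda>d. c * d)) (at z)"
    by (simp add: has_field_derivative_def)
  let ?y = "Im z"
  have y: "?y \<noteq> 0" using D_pos[OF z] by simp
  \<comment> \<open>Differentiating \<open>Im (h' z) = Im z * a1 z\<close> in the imaginary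
    direction gives Re c = a1 + y a12; \<open>a22\<close> comes from the real part in the same
    way.\<close>
  define a12 where "a12 = (Re c - a1 z) / ?y"
  have "((\<lambda>z. Im (h' z) / Im z) has_derivative (\<lambda>d. (Im c / ?y) * Re d + a12 * Im d)) (at z)"
    by (rule derivative_eq_intros dh y refl)+
      (use y in \<open>simp add: fun_eq_iff h'[OF z] a12_def field_simps power2_eq_square\<close>)
  then have 1: "(a1 has_derivative (\<lambda>d. (Im c / ?y) * Re d + a12 * Im d)) (at z)"
    by (rule has_derivative_transform_within_open[OF _ open_D z]) (use D_pos h' in force)
  define a22 where "a22 = - Im c / ?y - 2 * a2 z / ?y"
  have "((\<lambda>z. (Re (h' z) - a z) / Im z) has_derivative (\<lambda>d. a12 * Re d + a22 * Im d)) (at z)"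
    by (rule derivative_eq_intros dh da[OF z] y refl)+
      (use y in \<open>simp add: fun_eq_iff h'[OF z] a12_def a22_def field_simps power2_eq_square\<close>)
  then have 2: "(a2 has_derivative (\<lambda>d. a12 * Re d + a22 * Im d)) (at z)"
    by (rule has_derivative_transform_within_open[OF _ open_D z]) (use D_pos h' in force)
  show ?thesis
    by (rule that[OF 1 2]) (simp add: a22_def)
qed

text \<open>On E the companion has h' = k, and analytic continuation gives h' = k on D. Then h is
  affine, and its imaginary part y a determines a.\<close>

lemma unique_continuation:
  assumes E: "open E" "E \<subseteq> D" "E \<noteq> {}" and aE: "\<And>z. z \<in> E \<Longrightarrow> a z = k" and bE: "\<And>z. z \<in> E \<Longrightarrow> b z = 0"
    and z: "z \<in> D"
  shows "a z = k \<and> b z = 0"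
proof -
  obtain h where h: "\<And>z. z \<in> D \<Longrightarrow> (h has_field_derivative Complex (a z + Im z * a2 z) (Im z * a1 z)) (at z)"
    "\<And>z. z \<in> D \<Longrightarrow> Im (h z) = Im z * a z"
    using holomorphic_companion by metis
  define h' where "h' = deriv h"
  have h': "h' z = Complex (a z + Im z * a2 z) (Im z * a1 z)" if "z \<in> D" for z
    unfolding h'_def by (rule DERIV_imp_deriv[OF h(1)[OF that]])
  have "h holomorphic_on D"
    using h by (auto simp: holomorphic_on_def field_differentiable_def intro: has_field_derivative_at_within)
  then have holo: "h' holomorphic_on D"
    unfolding h'_def using open_D by (rule holomorphic_deriv)
  have a12E: "a1 z = 0 \<and> a2 z = 0" if "z \<in> E" for z
  proof -
    have "((\<lambda>z. k) has_derivative (\<lambda>h. a1 z * Re h + a2 z * Im h)) (at z)"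
      by (rule has_derivative_transform_within_open[OF da E(1) that]) (use aE E(2) that in auto)
    then have "(\<lambda>h. a1 z * Re h + a2 z * Im h) = (\<lambda>h. 0)"
      by (rule has_derivative_unique) simp
    from fun_cong[OF this, of 1] fun_cong[OF this, of \<i>] show ?thesis by simp
  qed
  obtain w where w: "w \<in> E" using E(3) by blast
  have h'D: "h' z = of_real k" if "z \<in> D" for z
  proof (rule analytic_continuation_open[OF E(1) open_D E(3) convex_connected[OF convex_D] E(2) holo _ _ that])
    show "h' z = of_real k" if "z \<in> E" for z
      using h'[of z] a12E[OF that] aE[OF that] E(2) that by (auto simp: complex_eq_iff)
  qed auto
  have a1: "a1 z = 0" "a z + Im z * a2 z = k" if "z \<in> D" for z
    using h'D[OF that] h'[OF that] D_pos[OF that] by (auto simp: complex_eq_iff)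
  have "\<exists>c. \<forall>z\<in>D. h z - of_real k * z = c"
  proof (rule has_derivative_zero_constant[OF convex_D])
    fix z assume "z \<in> D"
    then have "((\<lambda>z. h z - of_real k * z) has_field_derivative 0) (at z)"
      using h(1)[of z] h'[of z] h'D[of z] by (auto intro!: derivative_eq_intros)
    then show "((\<lambda>z. h z - of_real k * z) has_derivative (\<lambda>h. 0)) (at z within D)"
      by (auto simp: has_field_derivative_def lambda_zero intro: has_derivative_at_withinI)
  qed
  then obtain c where c: "\<And>z. z \<in> D \<Longrightarrow> h z - of_real k * z = c" by blast
  have "Im z * a z - k * Im z = Im c" if "z \<in> D" for z
    using arg_cong[OF c[OF that], of Im] h(2)[OF that] by simp
  moreover from this[of w] have "Im c = 0" using w E aE by auto
  ultimately have aD: "a z = k" if "z \<in> D" for z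
    using D_pos[OF that] that by fastforce
  \<comment> \<open>Once a is constant, the system reduces to b1 = 0 and b2 = -2 b / y, which says
    that y^2 b has zero differential.\<close>
  have a2: "a2 z = 0" if "z \<in> D" for z
    using a1(2)[OF that] aD[OF that] D_pos[OF that] by simp
  have "\<exists>c. \<forall>z\<in>D. (Im z)\<^sup>2 * b z = c"
  proof (rule has_derivative_zero_constant[OF convex_D])
    fix z assume z: "z \<in> D"
    then have "b1 z = 0" "b2 z = - 2 * b z / Im z"
      using sys1[OF z] sys2[OF z] a1(1)[OF z] a2[OF z] by auto
    then have "((\<lambda>z. (Im z)\<^sup>2 * b z) has_derivative (\<lambda>h. 0)) (at z)"
      using D_pos[OF z] db[OF z]
      by (auto intro!: derivative_eq_intros simp: fun_eq_iff field_simps power2_eq_square)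
    then show "((\<lambda>z. (Im z)\<^sup>2 * b z) has_derivative (\<lambda>h. 0)) (at z within D)"
      by (rule has_derivative_at_withinI)
  qed
  then obtain c' where c': "\<And>z. z \<in> D \<Longrightarrow> (Im z)\<^sup>2 * b z = c'" by blast
  have "c' = 0" using c'[of w] w E(2) bE by auto
  then show ?thesis using c'[OF z] D_pos[OF z] aD[OF z] by auto
qed

end

section \<open>The Laplacian along the lines of an adapted frame\<close>

definition radial :: "complex \<Rightarrow> real \<Rightarrow> real" where
  "radial z t = sqrt ((Im z)\<^sup>2 + t\<^sup>2) - Im z"

text \<open>\<open>radial z t\<close> is the growth of the distance to the axis after a tangential
  move of length t from height \<open>Im z\<close>. It vanishes to first order with second
  derivative 1 / y, the source of the first-order terms in the Laplacian.\<close>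

lemma radial_derivs:
  assumes y: "Im z > 0"
  shows "radial z 0 = 0"
    and "(radial z has_real_derivative t / sqrt ((Im z)\<^sup>2 + t\<^sup>2)) (at t)"
    and "((\<lambda>t. t / sqrt ((Im z)\<^sup>2 + t\<^sup>2)) has_real_derivative 1 / Im z) (at 0)"
proof -
  have p: "(Im z)\<^sup>2 + t\<^sup>2 > 0" for t using y by (simp add: add_pos_nonneg)
  show "radial z 0 = 0" using y by (simp add: radial_def)
  show "(radial z has_real_derivative t / sqrt ((Im z)\<^sup>2 + t\<^sup>2)) (at t)"
    unfolding radial_def using p[of t] by (auto intro!: derivative_eq_intros simp: field_simps)
  show "((\<lambda>t. t / sqrt ((Im z)\<^sup>2 + t\<^sup>2)) has_real_derivative 1 / Im z) (at 0)"
    using y p[of 0] by (auto intro!: derivative_eq_intros simp: field_simps power2_eq_square)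
qed

lemma DERIV_along_curve:
  fixes g :: "complex \<Rightarrow> real"
  assumes "(g has_derivative (\<lambda>h. p * Re h + q * Im h)) (at (z + s t *\<^sub>R w))"
    and "(s has_real_derivative s') (at t)"
  shows "((\<lambda>t. g (z + s t *\<^sub>R w)) has_real_derivative s' * (p * Re w + q * Im w)) (at t)"
proof -
  have "((\<lambda>t. z + s t *\<^sub>R w) has_derivative (\<lambda>r. (r * s') *\<^sub>R w)) (at t)"
    using assms(2) unfolding has_field_derivative_def
    by (auto intro!: derivative_eq_intros simp: mult.commute)
  from has_derivative_compose[OF this assms(1)] show ?thesis
    unfolding has_field_derivative_def
    by (rule has_derivative_eq_rhs) (simp add: fun_eq_iff algebra_simps)
qed

lemma DERIV_along_lines_0:
  fixes g :: "complex \<Rightarrow> real"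
  assumes "(g has_derivative (\<lambda>h. p * Re h + q * Im h)) (at z)"
  shows "((\<lambda>t. g (z + t *\<^sub>R w)) has_real_derivative p * Re w + q * Im w) (at 0)"
    and "((\<lambda>t. g (z + (- t) *\<^sub>R w)) has_real_derivative - (p * Re w + q * Im w)) (at 0)"
proof -
  show "((\<lambda>t. g (z + t *\<^sub>R w)) has_real_derivative p * Re w + q * Im w) (at 0)"
    using DERIV_along_curve[of g p q z "\<lambda>t. t" 0 w 1] assms by simp
  show "((\<lambda>t. g (z + (- t) *\<^sub>R w)) has_real_derivative - (p * Re w + q * Im w)) (at 0)"
    using DERIV_along_curve[of g p q z "\<lambda>t. - t" 0 w "- 1"] assms DERIV_minus[OF DERIV_ident, of 0 UNIV]
    by simp
qed

context vekua
begin

lemma eventually_curve_in: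
  fixes s :: "real \<Rightarrow> real"
  assumes "z \<in> D" "isCont s 0" "s 0 = 0"
  shows "\<forall>\<^sub>F t in nhds 0. z + s t *\<^sub>R w \<in> D"
proof -
  have "((\<lambda>t. z + s t *\<^sub>R w) \<longlongrightarrow> z + s 0 *\<^sub>R w) (nhds 0)"
    using assms(2) by (intro tendsto_intros) (simp add: isCont_def tendsto_nhds_iff)
  then show ?thesis
    using assms(1,3) open_D by (auto simp: tendsto_def)
qed

lemma eventually_in_D:
  assumes "z \<in> D"
  shows "\<forall>\<^sub>F t in nhds 0. z + t *\<^sub>R w \<in> D" "\<forall>\<^sub>F t in nhds 0. z + (- t) *\<^sub>R w \<in> D"
    "\<forall>\<^sub>F t in nhds 0. z + radial z t *\<^sub>R w \<in> D"
  using eventually_curve_in[OF assms, of "\<lambda>t. t" w] eventually_curve_in[OF assms, of "\<lambda>t. - t" w]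
    eventually_curve_in[OF assms DERIV_isCont[OF radial_derivs(2)[OF D_pos[OF assms]]] radial_derivs(1)[OF D_pos[OF assms]], of w]
  by auto

text \<open>Obtained by solving the system for b1 and b2 in terms of a1, a2 and b. The extra -2 b /
  y^2 is the angular eigenvalue l(l + 1) at l = 1, since b is multiplied by the direction I.\<close>

lemma b_second_derivatives:
  assumes z: "z \<in> D"
  obtains b11 b12 b21 b22 where
    "(b1 has_derivative (\<lambda>d. b11 * Re d + b12 * Im d)) (at z)"
    "(b2 has_derivative (\<lambda>d. b21 * Re d + b22 * Im d)) (at z)"
    "b11 + b22 + 2 * (b2 z / Im z - b z / (Im z)\<^sup>2) = 0"
proof -
  obtain a11 a12 a22 where a: "(a1 has_derivative (\<lambda>d. a11 * Re d + a12 * Im d)) (at z)"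
    "(a2 has_derivative (\<lambda>d. a12 * Re d + a22 * Im d)) (at z)"
    "a11 + a22 + 2 * a2 z / Im z = 0"
    by (rule second_derivatives[OF z])
  have y: "Im z \<noteq> 0" using D_pos[OF z] by simp
  have "((\<lambda>z. - a2 z) has_derivative (\<lambda>d. (- a12) * Re d + (- a22) * Im d)) (at z)"
    using has_derivative_minus[OF a(2)] by (simp add: algebra_simps)
  then have 1: "(b1 has_derivative (\<lambda>d. (- a12) * Re d + (- a22) * Im d)) (at z)"
    by (rule has_derivative_transform_within_open[OF _ open_D z]) (simp add: sys2)
  define b21 b22 where "b21 = a11 - 2 * b1 z / Im z"
    and "b22 = a12 - 2 * b2 z / Im z + 2 * b z / (Im z)\<^sup>2"
  have "((\<lambda>z. a1 z - 2 * b z / Im z) has_derivative (\<lambda>d. b21 * Re d + b22 * Im d)) (at z)"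
    by (rule derivative_eq_intros a(1) db[OF z] y refl)+
      (simp only: fun_eq_iff b21_def b22_def, rule allI,
       use y in \<open>simp add: divide_simps power2_eq_square\<close>, simp add: algebra_simps)
  then have 2: "(b2 has_derivative (\<lambda>d. b21 * Re d + b22 * Im d)) (at z)"
    by (rule has_derivative_transform_within_open[OF _ open_D z]) (simp add: sys1)
  show ?thesis
    by (rule that[OF 1 2]) (simp add: b22_def diff_divide_distrib)
qed

text \<open>The sum of a over both signs of the four frame directions. The two tangential directions
  with their signs all reach the same distance from the axis, whence the factor 4; the second
  derivative at 0 is 2 (a11 + a22 + 2 a2 / y).\<close>

lemma scalar_part_harmonic:
  assumes z: "z \<in> D"
  shows "\<exists>G. (\<forall>\<^sub>F t in nhds 0. ((\<lambda>t. a (z + t *\<^sub>R 1) + a (z + (- t) *\<^sub>R 1) + (a (z + t *\<^sub>R \<i>) + a (z + (- t) *\<^sub>R \<i>))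
      + 4 * a (z + radial z t *\<^sub>R \<i>)) has_real_derivative G t) (at t)) \<and> (G has_real_derivative 0) (at 0)"
proof -
  obtain a11 a12 a22 where a: "(a1 has_derivative (\<lambda>d. a11 * Re d + a12 * Im d)) (at z)"
    "(a2 has_derivative (\<lambda>d. a12 * Re d + a22 * Im d)) (at z)"
    "a11 + a22 + 2 * a2 z / Im z = 0"
    by (rule second_derivatives[OF z])
  note r = radial_derivs[OF D_pos[OF z]]
  let ?G = "\<lambda>t. a1 (z + t *\<^sub>R 1) - a1 (z + (- t) *\<^sub>R 1) + (a2 (z + t *\<^sub>R \<i>) - a2 (z + (- t) *\<^sub>R \<i>))
     + 4 * (t / sqrt ((Im z)\<^sup>2 + t\<^sup>2) * a2 (z + radial z t *\<^sub>R \<i>))"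
  have "\<forall>\<^sub>F t in nhds 0. ((\<lambda>t. a (z + t *\<^sub>R 1) + a (z + (- t) *\<^sub>R 1) + (a (z + t *\<^sub>R \<i>) + a (z + (- t) *\<^sub>R \<i>))
      + 4 * a (z + radial z t *\<^sub>R \<i>)) has_real_derivative ?G t) (at t)"
    using eventually_in_D(1)[OF z, of 1] eventually_in_D(2)[OF z, of 1] eventually_in_D(1)[OF z, of \<i>]
      eventually_in_D(2)[OF z, of \<i>] eventually_in_D(3)[OF z, of \<i>]
  proof eventually_elim
    case (elim t)
    show ?case
      by (rule derivative_eq_intros DERIV_along_curve[OF da] elim r(2) refl)+ simp
  qed
  moreover have "(?G has_real_derivative 0) (at 0)"
  proof -
    have a2: "(a2 has_derivative (\<lambda>d. a12 * Re d + a22 * Im d)) (at (z + radial z 0 *\<^sub>R \<i>))"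
      using a(2) by (simp add: r(1))
    show ?thesis
      by (rule DERIV_cong[OF DERIV_add[OF DERIV_add[OF
            DERIV_diff[OF DERIV_along_lines_0[OF a(1)]] DERIV_diff[OF DERIV_along_lines_0[OF a(2)]]]
            DERIV_cmult[OF DERIV_mult[OF r(3) DERIV_along_curve[OF a2 r(2)]]]]])
        (use a(3) in \<open>simp add: r(1)\<close>)
  qed
  ultimately show ?thesis by (intro exI[of _ ?G] conjI)
qed

text \<open>As for the scalar part, except that a tangential move also turns the direction. The
  factor \<open>Im z / sqrt ((Im z)\<^sup>2 + t\<^sup>2)\<close> is the cosine of that angle, the
  part that survives when both signs of t are added.\<close>

lemma vector_part_harmonic:
  assumes z: "z \<in> D"
  shows "\<exists>G. (\<forall>\<^sub>F t in nhds 0. ((\<lambda>t. b (z + t *\<^sub>R 1) + b (z + (- t) *\<^sub>R 1) + (b (z + t *\<^sub>R \<i>) + b (z + (- t) *\<^sub>R \<i>))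
      + 4 * (Im z * b (z + radial z t *\<^sub>R \<i>) / sqrt ((Im z)\<^sup>2 + t\<^sup>2))) has_real_derivative G t) (at t))
      \<and> (G has_real_derivative 0) (at 0)"
proof -
  obtain b11 b12 b21 b22 where b:
    "(b1 has_derivative (\<lambda>d. b11 * Re d + b12 * Im d)) (at z)"
    "(b2 has_derivative (\<lambda>d. b21 * Re d + b22 * Im d)) (at z)"
    "b11 + b22 + 2 * (b2 z / Im z - b z / (Im z)\<^sup>2) = 0"
    by (rule b_second_derivatives[OF z])
  note r = radial_derivs[OF D_pos[OF z]]
  have y: "Im z > 0" by (rule D_pos[OF z])
  then have p: "(Im z)\<^sup>2 + t\<^sup>2 > 0" for t by (simp add: add_pos_nonneg)
  let ?s = "\<lambda>t. sqrt ((Im z)\<^sup>2 + t\<^sup>2)"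
  have ds: "(?s has_real_derivative t / ?s t) (at t)" for t
    using p[of t] by (auto intro!: derivative_eq_intros simp: field_simps)
  let ?G = "\<lambda>t. b1 (z + t *\<^sub>R 1) - b1 (z + (- t) *\<^sub>R 1) + (b2 (z + t *\<^sub>R \<i>) - b2 (z + (- t) *\<^sub>R \<i>))
     + 4 * (t / ?s t * (Im z * (b2 (z + radial z t *\<^sub>R \<i>) / ?s t - b (z + radial z t *\<^sub>R \<i>) / (?s t)\<^sup>2)))"
  have "\<forall>\<^sub>F t in nhds 0. ((\<lambda>t. b (z + t *\<^sub>R 1) + b (z + (- t) *\<^sub>R 1) + (b (z + t *\<^sub>R \<i>) + b (z + (- t) *\<^sub>R \<i>))
      + 4 * (Im z * b (z + radial z t *\<^sub>R \<i>) / ?s t)) has_real_derivative ?G t) (at t)"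
    using eventually_in_D(1)[OF z, of 1] eventually_in_D(2)[OF z, of 1] eventually_in_D(1)[OF z, of \<i>]
      eventually_in_D(2)[OF z, of \<i>] eventually_in_D(3)[OF z, of \<i>]
  proof eventually_elim
    case (elim t)
    have s: "?s t \<noteq> 0" by (rule less_imp_neq[THEN not_sym, OF real_sqrt_gt_zero[OF p]])
    have last: "((\<lambda>t. Im z * b (z + radial z t *\<^sub>R \<i>) / ?s t) has_real_derivative
        t / ?s t * (Im z * (b2 (z + radial z t *\<^sub>R \<i>) / ?s t - b (z + radial z t *\<^sub>R \<i>) / (?s t)\<^sup>2))) (at t)"
    proof (rule DERIV_cong[OF DERIV_divide[OF DERIV_cmult[OF DERIV_along_curve[OF db[OF elim(5)] r(2)]] ds s]])
      have "(Im z * (t / s * \<beta>') * s - Im z * \<beta> * (t / s)) / (s * s) =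
          t / s * (Im z * (\<beta>' / s - \<beta> / s\<^sup>2))" if "s \<noteq> 0" for s \<beta> \<beta>' :: real
        using that by (simp add: divide_simps power2_eq_square) (simp add: algebra_simps)?
      from this[OF s] show "(Im z * (t / ?s t * (b1 (z + radial z t *\<^sub>R \<i>) * Re \<i> + b2 (z + radial z t *\<^sub>R \<i>) * Im \<i>)) * ?s t
          - Im z * b (z + radial z t *\<^sub>R \<i>) * (t / ?s t)) / (?s t * ?s t) =
          t / ?s t * (Im z * (b2 (z + radial z t *\<^sub>R \<i>) / ?s t - b (z + radial z t *\<^sub>R \<i>) / (?s t)\<^sup>2))"
        by (simp only: imaginary_unit.sel mult_zero_right mult_1_right add_0)
    qed
    show ?case
      by (rule DERIV_cong[OF DERIV_add[OF DERIV_add[OF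
            DERIV_add[OF DERIV_along_curve[OF db[OF elim(1)] DERIV_ident] DERIV_along_curve[OF db[OF elim(2)] DERIV_minus[OF DERIV_ident]]]
            DERIV_add[OF DERIV_along_curve[OF db[OF elim(3)] DERIV_ident] DERIV_along_curve[OF db[OF elim(4)] DERIV_minus[OF DERIV_ident]]]]
            DERIV_cmult[OF last]]]) simp
  qed
  moreover have "(?G has_real_derivative 0) (at 0)"
  proof -
    have s0: "?s 0 = Im z" "?s 0 \<noteq> 0" "(?s 0)\<^sup>2 \<noteq> 0" using y by auto
    have db': "(b has_derivative (\<lambda>h. b1 z * Re h + b2 z * Im h)) (at (z + radial z 0 *\<^sub>R \<i>))"
      "(b2 has_derivative (\<lambda>h. b21 * Re h + b22 * Im h)) (at (z + radial z 0 *\<^sub>R \<i>))"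
      using db[OF z] b(2) by (simp_all add: r(1))
    \<comment> \<open>The product rule at 0 multiplies this derivative by t / \<open>?s t\<close> at
      t = 0, which is 0, so \<open>deriv\<close> can stand for it unevaluated.\<close>
    have K: "((\<lambda>t. Im z * (b2 (z + radial z t *\<^sub>R \<i>) / ?s t - b (z + radial z t *\<^sub>R \<i>) / (?s t)\<^sup>2))
        has_real_derivative deriv (\<lambda>t. Im z * (b2 (z + radial z t *\<^sub>R \<i>) / ?s t - b (z + radial z t *\<^sub>R \<i>) / (?s t)\<^sup>2)) 0) (at 0)"
      unfolding DERIV_deriv_iff_field_differentiable field_differentiable_def
      by (rule exI, rule DERIV_cmult[OF DERIV_diff[OF DERIV_divide[OF DERIV_along_curve[OF db'(2) r(2)] ds s0(2)]
            DERIV_divide[OF DERIV_along_curve[OF db'(1) r(2)] DERIV_power[OF ds] s0(3)]]])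
    have "(?G has_real_derivative 2 * b11 + 2 * b22 + 4 * (1 / Im z * (Im z * (b2 z / Im z - b z / (Im z)\<^sup>2)))) (at 0)"
      by (rule DERIV_cong[OF DERIV_add[OF DERIV_add[OF
            DERIV_diff[OF DERIV_along_lines_0[OF b(1)]] DERIV_diff[OF DERIV_along_lines_0[OF b(2)]]]
            DERIV_cmult[OF DERIV_mult[OF r(3) K]]]]) (use y in \<open>simp add: r(1)\<close>)
    moreover have "2 * b11 + 2 * b22 + 4 * (1 / Im z * (Im z * (b2 z / Im z - b z / (Im z)\<^sup>2))) = 0"
      using b(3) y by simp
    ultimately show ?thesis by simp
  qed
  ultimately show ?thesis by (intro exI[of _ ?G] conjI)
qed

end

section \<open>Local description of slice Fueter-regular functions\<close>

lemma oct_inner_e: "x \<bullet> oct_e n = x $ n"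
  by (simp add: oct_e_def inner_axis)

lemma pos_8_iff: "0 < (m::8) \<longleftrightarrow> m \<noteq> 0"
proof -
  have "Rep_bit0 m \<ge> 0" using Rep_bit0[of m] by simp
  moreover have "Rep_bit0 (0::8) = 0" by (rule bit0.Rep_0)
  moreover have "Rep_bit0 m = Rep_bit0 (0::8) \<longleftrightarrow> m = 0" by (rule Rep_bit0_inject)
  ultimately show ?thesis by (auto simp: less_bit0_def)
qed

text \<open>Each \<open>m \<noteq> 0\<close> occurs in six of the 21 pairs.\<close>

lemma sum_pairs_8:
  fixes g :: "8 \<Rightarrow> 'a::real_vector"
  shows "(\<Sum>(m, n) | 0 < m \<and> m < n. g m + g n) = 6 *\<^sub>R (\<Sum>m | m \<noteq> 0. g m)"
proof -
  let ?P = "{(m, n). (0::8) < m \<and> m < n}" and ?Q = "{(m, n). (0::8) < n \<and> n < m}"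
  have "(\<Sum>(m, n)\<in>?P. g m + g n) = (\<Sum>(m, n)\<in>?P. g m) + (\<Sum>(m, n)\<in>?P. g n)"
    by (simp add: sum.distrib split_beta)
  also have "(\<Sum>(m, n)\<in>?P. g n) = (\<Sum>(m, n)\<in>?Q. g m)"
    by (rule sum.reindex_bij_witness[of _ prod.swap prod.swap]) auto
  also have "(\<Sum>(m, n)\<in>?P. g m) + \<dots> = (\<Sum>(m, n)\<in>?P \<union> ?Q. g m)"
    by (rule sum.union_disjoint[symmetric]) (auto intro: finite_subset[OF subset_UNIV])
  also have "?P \<union> ?Q = Sigma {m. m \<noteq> 0} (\<lambda>m. {n. n \<noteq> 0} - {m})"
    by (auto simp: pos_8_iff dest: less_trans intro: order.strict_trans)
  also have "(\<Sum>(m, n)\<in>\<dots>. g m) = (\<Sum>m | m \<noteq> 0. \<Sum>n\<in>{n. n \<noteq> 0} - {m}. g m)"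
    by (rule sum.Sigma[symmetric]) auto
  also have "\<dots> = (\<Sum>m | m \<noteq> 0. 6 *\<^sub>R g m)"
  proof (rule sum.cong[OF refl])
    fix m :: 8 assume m: "m \<in> {m. m \<noteq> 0}"
    have "card {n::8. n \<noteq> 0} = 7" unfolding nonzero_8 by simp
    then have "card ({n. n \<noteq> 0} - {m}) = 6" using m by simp
    then show "(\<Sum>n\<in>{n. n \<noteq> 0} - {m}. g m) = 6 *\<^sub>R g m"
      by (simp add: sum_constant_scaleR)
  qed
  finally show ?thesis by (simp add: scaleR_sum_right)
qed

section \<open>Polar coordinates around the real axis\<close>

definition oct_pt :: "complex \<Rightarrow> octonion \<Rightarrow> octonion" where
  "oct_pt z I = oct_of_real (Re z) + Im z *\<^sub>R I"

definition oct_zeta :: "octonion \<Rightarrow> complex" where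
  "oct_zeta x = Complex (x $ 0) (norm (oct_Im x))"

definition oct_dir :: "octonion \<Rightarrow> octonion" where
  "oct_dir x = oct_Im x /\<^sub>R norm (oct_Im x)"

lemma oct_pt_zeta_dir: "oct_Im x \<noteq> 0 \<Longrightarrow> oct_pt (oct_zeta x) (oct_dir x) = x"
  by (simp add: oct_pt_def oct_zeta_def oct_dir_def oct_of_real_def oct_Im_eq)

lemma oct_dir_sphere: "oct_Im x \<noteq> 0 \<Longrightarrow> oct_dir x \<in> oct_sphere"
  by (simp add: oct_dir_def oct_sphere_iff)

lemma oct_pt_nth_0: "I \<in> oct_sphere \<Longrightarrow> oct_pt z I $ 0 = Re z"
  by (simp add: oct_pt_def oct_of_real_def oct_sphere_iff oct_e_nth)

lemma oct_Im_pt: "I \<in> oct_sphere \<Longrightarrow> oct_Im (oct_pt z I) = Im z *\<^sub>R I"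
  using oct_pt_nth_0[of I z] by (simp add: oct_Im_eq oct_pt_def oct_of_real_def)

lemma oct_zeta_pt: "I \<in> oct_sphere \<Longrightarrow> Im z > 0 \<Longrightarrow> oct_zeta (oct_pt z I) = z"
  by (simp add: oct_zeta_def oct_pt_nth_0 oct_Im_pt complex_eq_iff) (simp add: oct_sphere_iff)

lemma oct_dir_pt: "I \<in> oct_sphere \<Longrightarrow> Im z > 0 \<Longrightarrow> oct_dir (oct_pt z I) = I"
  by (simp add: oct_dir_def oct_Im_pt) (simp add: oct_sphere_iff)

lemma oct_pt_diff: "oct_pt z I - oct_pt w I = oct_pt (z - w) I"
  by (simp add: oct_pt_def oct_of_real_def algebra_simps)

lemma oct_pt_add_real: "oct_pt z I + t *\<^sub>R oct_e 0 = oct_pt (z + t *\<^sub>R 1) I"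
  and oct_pt_add_imag: "oct_pt z I + t *\<^sub>R I = oct_pt (z + t *\<^sub>R \<i>) I"
  by (simp_all add: oct_pt_def oct_of_real_def algebra_simps)

lemma continuous_oct_Im: "continuous_on S oct_Im"
  unfolding oct_Im_eq by (intro continuous_intros)

lemma continuous_oct_zeta: "continuous_on S oct_zeta"
  unfolding oct_zeta_def by (intro continuous_on_Complex continuous_intros continuous_oct_Im)

lemma continuous_oct_dir: "(\<And>x. x \<in> S \<Longrightarrow> oct_Im x \<noteq> 0) \<Longrightarrow> continuous_on S oct_dir"
  unfolding oct_dir_def by (intro continuous_intros continuous_oct_Im) auto

lemma has_derivative_oct_pt: "((\<lambda>z. oct_pt z I) has_derivative (\<lambda>h. oct_pt h I)) F"
  unfolding oct_pt_def oct_of_real_def by (auto intro!: derivative_eq_intros)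

text \<open>A product piece D x \<Lambda> of the domain carrying one pair u, v. No regularity of u
  and v is postulated: the two distinct units \<open>I1\<close>, \<open>I2\<close> allow solving for
  them. Relative openness of \<Lambda> lets f be followed in tangential directions.\<close>

locale slice_chart =
  fixes f :: "octonion \<Rightarrow> octonion" and f' :: "octonion \<Rightarrow> octonion \<Rightarrow>\<^sub>L octonion"
    and D :: "complex set" and \<Lambda> :: "octonion set" and u v :: "complex \<Rightarrow> octonion"
    and I1 I2 :: octonion
  assumes open_D: "open D" and convex_D: "convex D" and D_pos: "\<And>z. z \<in> D \<Longrightarrow> Im z > 0"
    and \<Lambda>: "openin (top_of_set oct_sphere) \<Lambda>" "I1 \<in> \<Lambda>" "I2 \<in> \<Lambda>" "I1 \<noteq> I2"
    and df: "\<And>z I. z \<in> D \<Longrightarrow> I \<in> \<Lambda> \<Longrightarrow> (f has_derivative blinfun_apply (f' (oct_pt z I))) (at (oct_pt z I))"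
    and cont: "\<And>I. I \<in> \<Lambda> \<Longrightarrow> continuous_on D (\<lambda>z. f' (oct_pt z I))"
    and rep: "\<And>z I. z \<in> D \<Longrightarrow> I \<in> \<Lambda> \<Longrightarrow> f (oct_pt z I) = u z + I \<odot> v z"
    and dbar: "\<And>z I. z \<in> D \<Longrightarrow> I \<in> \<Lambda> \<Longrightarrow> dbar_F f (oct_pt z I) = 0"
begin

text \<open>The image of D x \<Lambda> under \<open>oct_pt\<close>, described by the inverse
  coordinates so that openness follows from their continuity.\<close>

definition chart_dom :: "octonion set" where
  "chart_dom = {x. oct_Im x \<noteq> 0 \<and> oct_zeta x \<in> D \<and> oct_dir x \<in> \<Lambda>}"

lemma \<Lambda>_sphere: "I \<in> \<Lambda> \<Longrightarrow> I \<in> oct_sphere"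
  using openin_imp_subset[OF \<Lambda>(1)] by auto

lemma open_chart_dom: "open chart_dom"
proof -
  obtain U where U: "open U" "\<Lambda> = oct_sphere \<inter> U"
    using \<Lambda>(1) by (auto simp: openin_open)
  let ?N = "{x. oct_Im x \<noteq> 0}"
  have N: "open ?N"
    by (intro open_Collect_neq continuous_oct_Im continuous_intros)
  have "chart_dom = (?N \<inter> oct_zeta -` D) \<inter> (?N \<inter> oct_dir -` U)"
    unfolding chart_dom_def by (auto simp: U(2) intro: oct_dir_sphere)
  then show ?thesis
    using continuous_open_preimage[OF continuous_oct_zeta N open_D]
      continuous_open_preimage[OF continuous_oct_dir N U(1)] by (auto intro: open_Int)
qed

lemma oct_pt_in_chart: "z \<in> D \<Longrightarrow> I \<in> \<Lambda> \<Longrightarrow> oct_pt z I \<in> chart_dom"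
  using D_pos[of z] \<Lambda>_sphere[of I]
  by (auto simp: chart_dom_def oct_Im_pt oct_zeta_pt oct_dir_pt) (auto simp: oct_sphere_iff)

lemma chart_rep:
  assumes "x \<in> chart_dom"
  shows "f x = u (oct_zeta x) + (1 / Im (oct_zeta x)) *\<^sub>R (oct_Im x \<odot> v (oct_zeta x))"
proof -
  have "f x = u (oct_zeta x) + oct_dir x \<odot> v (oct_zeta x)"
    using rep[of "oct_zeta x" "oct_dir x"] assms oct_pt_zeta_dir[of x] by (simp add: chart_dom_def)
  then show ?thesis
    by (simp add: oct_dir_def oct_zeta_def oct_mult.scaleR_left divide_inverse)
qed

definition fx where "fx I z = f' (oct_pt z I) (oct_e 0)"
definition fy where "fy I z = f' (oct_pt z I) I"

lemma slice_derivative: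
  assumes "z \<in> D" "I \<in> \<Lambda>"
  shows "((\<lambda>z. f (oct_pt z I)) has_derivative (\<lambda>h. Re h *\<^sub>R fx I z + Im h *\<^sub>R fy I z)) (at z)"
  using has_derivative_compose[OF has_derivative_oct_pt df[OF assms]]
  by (simp add: fx_def fy_def oct_pt_def oct_of_real_def blinfun.add_right blinfun.scaleR_right)

lemma continuous_fx_fy: "I \<in> \<Lambda> \<Longrightarrow> continuous_on D (fx I)" "I \<in> \<Lambda> \<Longrightarrow> continuous_on D (fy I)"
  unfolding fx_def fy_def by (intro continuous_intros cont; assumption)+

text \<open>This is (I1 - I2)^(-1) (x - y), with the inverse of an imaginary octonion written out.
  It is linear in x and y, so u and v inherit the C^1 regularity of f.\<close>

definition solve_v where
  "solve_v x y = (- 1 / (norm (I1 - I2))\<^sup>2) *\<^sub>R ((I1 - I2) \<odot> (x - y))"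

lemma solve_v: "solve_v (p + I1 \<odot> q) (p + I2 \<odot> q) = q"
proof -
  have "(I1 - I2) $ 0 = 0" using \<Lambda>_sphere \<Lambda>(2,3) by (auto simp: oct_sphere_iff)
  moreover have "p + I1 \<odot> q - (p + I2 \<odot> q) = (I1 - I2) \<odot> q" by (simp add: oct_mult.diff_left)
  ultimately show ?thesis using \<Lambda>(4) by (simp add: solve_v_def oct_mult_left_alt)
qed

definition vx where "vx z = solve_v (fx I1 z) (fx I2 z)"
definition vy where "vy z = solve_v (fy I1 z) (fy I2 z)"
definition ux where "ux z = fx I1 z - I1 \<odot> vx z"
definition uy where "uy z = fy I1 z - I1 \<odot> vy z"

lemma v_derivative:
  assumes z: "z \<in> D"
  shows "(v has_derivative (\<lambda>h. Re h *\<^sub>R vx z + Im h *\<^sub>R vy z)) (at z)"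
proof -
  have "((\<lambda>z. solve_v (f (oct_pt z I1)) (f (oct_pt z I2))) has_derivative
      (\<lambda>h. solve_v (Re h *\<^sub>R fx I1 z + Im h *\<^sub>R fy I1 z) (Re h *\<^sub>R fx I2 z + Im h *\<^sub>R fy I2 z))) (at z)"
    unfolding solve_v_def
    by (intro has_derivative_scaleR_right oct_mult.bounded_linear_right[THEN bounded_linear.has_derivative]
        has_derivative_diff slice_derivative z \<Lambda>)
  then have "((\<lambda>z. solve_v (f (oct_pt z I1)) (f (oct_pt z I2))) has_derivative
      (\<lambda>h. Re h *\<^sub>R vx z + Im h *\<^sub>R vy z)) (at z)"
    by (rule has_derivative_eq_rhs)
      (simp add: fun_eq_iff vx_def vy_def solve_v_def oct_mult.diff_right oct_mult.add_right
        oct_mult.scaleR_right algebra_simps)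
  then show ?thesis
    by (rule has_derivative_transform_within_open[OF _ open_D z]) (simp add: rep \<Lambda> solve_v)
qed

lemma u_derivative:
  assumes z: "z \<in> D"
  shows "(u has_derivative (\<lambda>h. Re h *\<^sub>R ux z + Im h *\<^sub>R uy z)) (at z)"
proof -
  have "((\<lambda>z. f (oct_pt z I1) - I1 \<odot> v z) has_derivative
      (\<lambda>h. Re h *\<^sub>R fx I1 z + Im h *\<^sub>R fy I1 z - I1 \<odot> (Re h *\<^sub>R vx z + Im h *\<^sub>R vy z))) (at z)"
    by (intro oct_mult.bounded_linear_right[THEN bounded_linear.has_derivative]
        has_derivative_diff slice_derivative v_derivative z \<Lambda>)
  then have "((\<lambda>z. f (oct_pt z I1) - I1 \<odot> v z) has_derivative
      (\<lambda>h. Re h *\<^sub>R ux z + Im h *\<^sub>R uy z)) (at z)"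
    by (rule has_derivative_eq_rhs)
      (simp add: fun_eq_iff ux_def uy_def oct_mult.add_right oct_mult.scaleR_right algebra_simps)
  then show ?thesis
    by (rule has_derivative_transform_within_open[OF _ open_D z]) (simp add: rep \<Lambda>)
qed

text \<open>\<open>ux\<close>, \<open>uy\<close>, \<open>vx\<close>, \<open>vy\<close> were built
  from the two units \<open>I1\<close>, \<open>I2\<close>; uniqueness of the derivative lets them
  serve every direction of \<Lambda>.\<close>

lemma fx_fy_eq:
  assumes "z \<in> D" "I \<in> \<Lambda>"
  shows "fx I z = ux z + I \<odot> vx z" "fy I z = uy z + I \<odot> vy z"
proof -
  have "((\<lambda>z. u z + I \<odot> v z) has_derivative
      (\<lambda>h. (Re h *\<^sub>R ux z + Im h *\<^sub>R uy z) + I \<odot> (Re h *\<^sub>R vx z + Im h *\<^sub>R vy z))) (at z)"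
    by (intro oct_mult.bounded_linear_right[THEN bounded_linear.has_derivative]
        has_derivative_add u_derivative v_derivative assms)
  then have "((\<lambda>z. f (oct_pt z I)) has_derivative
      (\<lambda>h. (Re h *\<^sub>R ux z + Im h *\<^sub>R uy z) + I \<odot> (Re h *\<^sub>R vx z + Im h *\<^sub>R vy z))) (at z)"
    by (rule has_derivative_transform_within_open[OF _ open_D assms(1)]) (simp add: rep assms)
  from has_derivative_unique[OF slice_derivative[OF assms] this]
  have *: "Re h *\<^sub>R fx I z + Im h *\<^sub>R fy I z = (Re h *\<^sub>R ux z + Im h *\<^sub>R uy z) + I \<odot> (Re h *\<^sub>R vx z + Im h *\<^sub>R vy z)" for h
    by (rule fun_cong)
  show "fx I z = ux z + I \<odot> vx z" "fy I z = uy z + I \<odot> vy z"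
    using *[of 1] *[of \<i>] by simp_all
qed

lemma continuous_partials: "continuous_on D ux" "continuous_on D uy" "continuous_on D vx" "continuous_on D vy"
  unfolding ux_def uy_def vx_def vy_def solve_v_def
  by (intro continuous_intros oct_mult.continuous_on continuous_fx_fy \<Lambda>)+

text \<open>Moving from a + yI by tT changes the height to the hypotenuse of y and t and turns the
  direction to (yI + tT) divided by it.\<close>

lemma chart_orthogonal_line:
  assumes z: "z \<in> D" and I: "I \<in> \<Lambda>" and T: "T \<in> oct_sphere" "orthogonal I T"
  shows "\<forall>\<^sub>F t in nhds 0. f (oct_pt z I + t *\<^sub>R T) = u (z + radial z t *\<^sub>R \<i>)
    + (1 / sqrt ((Im z)\<^sup>2 + t\<^sup>2)) *\<^sub>R ((Im z *\<^sub>R I + t *\<^sub>R T) \<odot> v (z + radial z t *\<^sub>R \<i>))"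
proof -
  have IS: "I \<in> oct_sphere" by (rule \<Lambda>_sphere[OF I])
  have "((\<lambda>t. oct_pt z I + t *\<^sub>R T) \<longlongrightarrow> oct_pt z I + 0 *\<^sub>R T) (nhds 0)"
    by (intro tendsto_intros filterlim_ident)
  then have "((\<lambda>t. oct_pt z I + t *\<^sub>R T) \<longlongrightarrow> oct_pt z I) (nhds 0)" by simp
  from topological_tendstoD[OF this open_chart_dom oct_pt_in_chart[OF z I]]
  show ?thesis
  proof eventually_elim
    case (elim t)
    let ?x = "oct_pt z I + t *\<^sub>R T"
    have re: "?x $ 0 = Re z" using oct_pt_nth_0[OF IS] T by (simp add: oct_sphere_iff)
    have im: "oct_Im ?x = Im z *\<^sub>R I + t *\<^sub>R T"
      using re by (simp add: oct_Im_eq) (simp add: oct_pt_def oct_of_real_def)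
    have "(norm (Im z *\<^sub>R I + t *\<^sub>R T))\<^sup>2 = (Im z)\<^sup>2 + t\<^sup>2"
      unfolding power2_norm_eq_inner
      using IS T by (simp add: inner_add oct_sphere_iff orthogonal_def norm_eq_1
          inner_commute[of T I] power2_eq_square)
    then have "norm (Im z *\<^sub>R I + t *\<^sub>R T) = sqrt ((Im z)\<^sup>2 + t\<^sup>2)"
      by (metis norm_ge_zero real_sqrt_unique)
    then have "oct_zeta ?x = z + radial z t *\<^sub>R \<i>"
      unfolding oct_zeta_def re im by (simp add: complex_eq_iff radial_def)
    then show ?case using chart_rep[OF elim] im by (simp add: radial_def)
  qed
qed

text \<open>To first order a tangential move leaves the height unchanged, so u, v and the
  normalizing factor stay fixed and only the direction varies, at rate T / y.\<close>

lemma tangential_derivative_unit: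
  assumes z: "z \<in> D" and I: "I \<in> \<Lambda>" and T: "T \<in> oct_sphere" "orthogonal I T"
  shows "f' (oct_pt z I) T = (1 / Im z) *\<^sub>R (T \<odot> v z)"
proof -
  let ?x = "oct_pt z I" and ?c = "\<lambda>t. z + radial z t *\<^sub>R \<i>"
  have y: "Im z > 0" by (rule D_pos[OF z])
  have "(radial z has_derivative (\<lambda>r. 0)) (at 0)"
    using radial_derivs(2)[OF y, of 0] by (simp add: has_field_derivative_def lambda_zero)
  then have c: "(?c has_derivative (\<lambda>r. 0)) (at 0)"
    by (auto intro!: derivative_eq_intros)
  have c0: "?c 0 = z" using radial_derivs(1)[OF y] by simp
  have du: "((\<lambda>t. u (?c t)) has_derivative (\<lambda>r. 0)) (at 0)"
    and dv: "((\<lambda>t. v (?c t)) has_derivative (\<lambda>r. 0)) (at 0)"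
    using has_derivative_compose[OF c, where g=u and g'="\<lambda>h. Re h *\<^sub>R ux z + Im h *\<^sub>R uy z", unfolded c0, OF u_derivative[OF z]]
      has_derivative_compose[OF c, where g=v and g'="\<lambda>h. Re h *\<^sub>R vx z + Im h *\<^sub>R vy z", unfolded c0, OF v_derivative[OF z]]
    by simp_all
  have di: "((\<lambda>t. 1 / sqrt ((Im z)\<^sup>2 + t\<^sup>2)) has_derivative (\<lambda>r. 0)) (at 0)"
  proof -
    have "((\<lambda>t. 1 / sqrt ((Im z)\<^sup>2 + t\<^sup>2)) has_real_derivative 0) (at 0)"
      using y by (auto intro!: derivative_eq_intros)
    then show ?thesis by (simp add: has_field_derivative_def lambda_zero)
  qed
  have dl: "((\<lambda>t. Im z *\<^sub>R I + t *\<^sub>R T) has_derivative (\<lambda>r. r *\<^sub>R T)) (at 0)"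
    by (auto intro!: derivative_eq_intros)
  let ?r = "\<lambda>t. u (?c t) + (1 / sqrt ((Im z)\<^sup>2 + t\<^sup>2)) *\<^sub>R ((Im z *\<^sub>R I + t *\<^sub>R T) \<odot> v (?c t))"
  have 1: "(?r has_derivative
      (\<lambda>r. r *\<^sub>R ((1 / Im z) *\<^sub>R (T \<odot> v z)))) (at 0)"
    by (rule has_derivative_eq_rhs[OF has_derivative_add[OF du has_derivative_scaleR[OF di oct_mult.FDERIV[OF dl dv]]]])
      (use y in \<open>simp add: fun_eq_iff c0 radial_derivs(1)[OF y] oct_mult.scaleR_left oct_mult.zero_right\<close>)
  have 2: "((\<lambda>t. f (?x + t *\<^sub>R T)) has_derivative (\<lambda>r. r *\<^sub>R f' ?x T)) (at 0)"
  proof -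
    have "((\<lambda>t. ?x + t *\<^sub>R T) has_derivative (\<lambda>r. r *\<^sub>R T)) (at 0)"
      by (auto intro!: derivative_eq_intros)
    from has_derivative_compose[OF this, of f "f' ?x"] df[OF z I] show ?thesis
      by (simp add: blinfun.scaleR_right)
  qed
  have "\<forall>\<^sub>F t in nhds 0. f (?x + t *\<^sub>R T) = ?r t"
    by (rule chart_orthogonal_line[OF assms])
  then obtain S where S: "open S" "0 \<in> S" "\<And>t. t \<in> S \<Longrightarrow> f (?x + t *\<^sub>R T) = ?r t"
    unfolding eventually_nhds by blast
  have "((\<lambda>t. f (?x + t *\<^sub>R T)) has_derivative (\<lambda>r. r *\<^sub>R ((1 / Im z) *\<^sub>R (T \<odot> v z)))) (at 0)"
    by (rule has_derivative_transform_within_open[OF 1 S(1,2)]) (simp add: S(3))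
  with 2 have "(\<lambda>r. r *\<^sub>R f' ?x T) = (\<lambda>r. r *\<^sub>R ((1 / Im z) *\<^sub>R (T \<odot> v z)))"
    by (rule has_derivative_unique)
  from fun_cong[OF this, of 1] show ?thesis by simp
qed

lemma tangential_derivative:
  fixes T :: octonion
  assumes z: "z \<in> D" and I: "I \<in> \<Lambda>" and T: "T $ 0 = 0" "orthogonal I T"
  shows "f' (oct_pt z I) T = (1 / Im z) *\<^sub>R (T \<odot> v z)"
proof (cases "T = 0")
  case False
  have "T /\<^sub>R norm T \<in> oct_sphere" using T(1) False by (simp add: oct_sphere_iff)
  moreover have "orthogonal I (T /\<^sub>R norm T)" using T(2) by (simp add: orthogonal_def)
  ultimately have "f' (oct_pt z I) (T /\<^sub>R norm T) = (1 / Im z) *\<^sub>R ((T /\<^sub>R norm T) \<odot> v z)"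
    by (rule tangential_derivative_unit[OF z I])
  then have "norm T *\<^sub>R f' (oct_pt z I) (T /\<^sub>R norm T) = norm T *\<^sub>R ((1 / Im z) *\<^sub>R ((T /\<^sub>R norm T) \<odot> v z))"
    by simp
  then show ?thesis
    using False by (simp add: blinfun.scaleR_right oct_mult.scaleR_left)
qed (simp add: blinfun.zero_right oct_mult.zero_left)

section \<open>The operator \<open>dbar_F\<close> in a chart\<close>

lemma oct_partial_eq:
  assumes "z \<in> D" "I \<in> \<Lambda>"
  shows "oct_partial n f (oct_pt z I) = f' (oct_pt z I) (oct_e n)"
proof -
  let ?x = "oct_pt z I"
  have "((\<lambda>t. ?x + t *\<^sub>R oct_e n) has_derivative (\<lambda>r. r *\<^sub>R oct_e n)) (at 0)"
    by (auto intro!: derivative_eq_intros)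
  from has_derivative_compose[OF this, of f "f' ?x"] df[OF assms]
  have "((\<lambda>t. f (?x + t *\<^sub>R oct_e n)) has_vector_derivative f' ?x (oct_e n)) (at 0)"
    by (simp add: blinfun.scaleR_right has_vector_derivative_def)
  then show ?thesis unfolding oct_partial_def by (rule vector_derivative_at)
qed

text \<open>\<open>oct_L m n\<close> differentiates along the rotation field of the plane of
  \<open>oct_e m\<close> and \<open>oct_e n\<close>. That field is orthogonal to I, so the
  tangential formula applies; its length y cancels the factor 1 / y.\<close>

lemma oct_L_eq:
  assumes "z \<in> D" "I \<in> \<Lambda>" "m \<noteq> 0" "n \<noteq> 0"
  shows "oct_L m n f (oct_pt z I) = (I $ m *\<^sub>R oct_e n - I $ n *\<^sub>R oct_e m) \<odot> v z"
proof -
  let ?x = "oct_pt z I" and ?T = "I $ m *\<^sub>R oct_e n - I $ n *\<^sub>R oct_e m"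
  have x: "?x $ k = Im z * I $ k" if "k \<noteq> 0" for k
    using that by (simp add: oct_pt_def oct_of_real_def oct_e_nth)
  have "oct_L m n f ?x = Im z *\<^sub>R f' ?x ?T"
    using assms by (simp add: oct_L_def oct_partial_eq x blinfun.diff_right blinfun.scaleR_right algebra_simps)
  also have "f' ?x ?T = (1 / Im z) *\<^sub>R (?T \<odot> v z)"
    using assms(3,4)
    by (intro tangential_derivative assms)
      (simp_all add: oct_e_nth orthogonal_def inner_diff_right oct_inner_e)
  finally show ?thesis using D_pos[OF assms(1)] by simp
qed

text \<open>The pair m, n contributes the two components of I with these indices applied to v, and
  every index lies in six pairs.\<close>

lemma Gamma_eq:
  assumes z: "z \<in> D" and I: "I \<in> \<Lambda>"
  shows "oct_Gamma f (oct_pt z I) = 6 *\<^sub>R (I \<odot> v z)"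
proof -
  let ?g = "\<lambda>m. (I $ m *\<^sub>R oct_e m) \<odot> v z"
  have e: "oct_e k \<in> oct_sphere" if "k \<noteq> 0" for k
    using that by (simp add: oct_sphere_iff oct_e_nth)
  have term_eq: "oct_e m \<odot> (oct_e n \<odot> oct_L m n f (oct_pt z I)) = - (?g m + ?g n)"
    if mn: "m \<noteq> 0" "n \<noteq> 0" "m \<noteq> n" for m n
  proof -
    \<comment> \<open>Anticommutation of left multiplications as operators takes the place of
      reassociating the triple product.\<close>
    have anti: "oct_e n \<odot> (oct_e m \<odot> w) = - (oct_e m \<odot> (oct_e n \<odot> w))" for w
      using oct_mult_polar[of "oct_e m" "oct_e n" w] mn
      by (simp add: oct_e_nth oct_inner_e eq_neg_iff_add_eq_0 add.commute)
    show ?thesis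
      using mn oct_sphere_square[OF e]
      by (simp add: oct_L_eq[OF z I] oct_mult.diff_left oct_mult.diff_right oct_mult.scaleR_left
          oct_mult.scaleR_right oct_mult.minus_right anti)
  qed
  have "oct_Gamma f (oct_pt z I) = - (\<Sum>(m, n) | 0 < m \<and> m < n. - (?g m + ?g n))"
    unfolding oct_Gamma_def
  proof (intro arg_cong[where f=uminus] sum.cong refl, clarify)
    fix m n :: 8 assume "0 < m" "m < n"
    then have "m \<noteq> 0" "n \<noteq> 0" "m \<noteq> n" using less_trans[of 0 m n] by (auto simp: pos_8_iff)
    then show "oct_e m \<odot> (oct_e n \<odot> oct_L m n f (oct_pt z I)) = - (?g m + ?g n)" by (rule term_eq)
  qed
  also have "\<dots> = 6 *\<^sub>R (\<Sum>m | m \<noteq> 0. ?g m)"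
    unfolding sum_pairs_8[of ?g, symmetric] sum_negf[symmetric] by (rule sum.cong) auto
  also have "(\<Sum>m | m \<noteq> 0. ?g m) = oct_Im I \<odot> v z"
    unfolding oct_Im_def by (rule oct_mult.sum_left[symmetric])
  also have "oct_Im I = I" using \<Lambda>_sphere[OF I] by (simp add: oct_Im_eq oct_sphere_iff)
  finally show ?thesis .
qed

lemma Euler_eq:
  assumes z: "z \<in> D" and I: "I \<in> \<Lambda>"
  shows "oct_Euler f (oct_pt z I) = Im z *\<^sub>R fy I z"
proof -
  let ?x = "oct_pt z I"
  have "oct_Euler f ?x = f' ?x (oct_Im ?x)"
    by (simp add: oct_Euler_def oct_partial_eq[OF assms] oct_Im_def blinfun.sum_right blinfun.scaleR_right)
  then show ?thesis
    by (simp add: oct_Im_pt[OF \<Lambda>_sphere[OF I]] blinfun.scaleR_right fy_def)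
qed

text \<open>In a chart \<open>dbar_F f\<close> has the form p + I q with p, q depending on z alone,
  so its vanishing for the two units \<open>I1\<close> and \<open>I2\<close> forces p = q = 0. The
  coefficient 2 is the 6 of \<open>Gamma_eq\<close> divided by 3.\<close>

lemma fueter_system:
  assumes z: "z \<in> D"
  shows "ux z = vy z + (2 / Im z) *\<^sub>R v z" "uy z = - vx z"
proof -
  have y: "Im z > 0" by (rule D_pos[OF z])
  let ?p = "ux z - vy z - (2 / Im z) *\<^sub>R v z" and ?q = "vx z + uy z"
  have *: "?p + I \<odot> ?q = 0" if I: "I \<in> \<Lambda>" for I
  proof -
    note sq = oct_sphere_square[OF \<Lambda>_sphere[OF I]]
    have "0 = dbar_F f (oct_pt z I)" using dbar[OF z I] by simp
    also have "\<dots> = fx I z + (1 / Im z) *\<^sub>R (I \<odot> (Im z *\<^sub>R fy I z))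
        + (1 / 3) *\<^sub>R ((1 / Im z) *\<^sub>R (I \<odot> (6 *\<^sub>R (I \<odot> v z))))"
      unfolding dbar_F_def Gamma_eq[OF z I] Euler_eq[OF z I] oct_partial_eq[OF z I] fx_def
        oct_Im_pt[OF \<Lambda>_sphere[OF I]] oct_inv_imag[OF \<Lambda>_sphere[OF I] y]
      by (simp add: oct_mult.minus_left oct_mult.scaleR_left)
    also have "\<dots> = ?p + I \<odot> ?q"
      using y by (simp add: fx_fy_eq[OF z I] oct_mult.scaleR_right oct_mult.add_right sq algebra_simps)
    finally show ?thesis by simp
  qed
  have "solve_v 0 0 = ?q"
    using solve_v[of ?p ?q] *[OF \<Lambda>(2)] *[OF \<Lambda>(3)] by simp
  then have q: "?q = 0" by (simp add: solve_v_def oct_mult.zero_right)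
  then show "uy z = - vx z" by (simp add: eq_neg_iff_add_eq_0 add.commute)
  show "ux z = vy z + (2 / Im z) *\<^sub>R v z"
    using *[OF \<Lambda>(2)] q by (simp add: oct_mult.zero_right algebra_simps)
qed

text \<open>No octonion product is left in the system and its coefficients are real, so pairing with
  a fixed vector preserves it.\<close>

lemma vekua_component:
  "vekua D (\<lambda>z. u z \<bullet> d) (\<lambda>z. v z \<bullet> d) (\<lambda>z. ux z \<bullet> d) (\<lambda>z. uy z \<bullet> d) (\<lambda>z. vx z \<bullet> d) (\<lambda>z. vy z \<bullet> d)"
proof
  show "((\<lambda>z. u z \<bullet> d) has_derivative (\<lambda>h. ux z \<bullet> d * Re h + uy z \<bullet> d * Im h)) (at z)" if "z \<in> D" for z
    by (rule has_derivative_eq_rhs[OF has_derivative_inner_left[OF u_derivative[OF that]]])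
      (simp add: fun_eq_iff inner_add_left mult.commute)
  show "((\<lambda>z. v z \<bullet> d) has_derivative (\<lambda>h. vx z \<bullet> d * Re h + vy z \<bullet> d * Im h)) (at z)" if "z \<in> D" for z
    by (rule has_derivative_eq_rhs[OF has_derivative_inner_left[OF v_derivative[OF that]]])
      (simp add: fun_eq_iff inner_add_left mult.commute)
  show "ux z \<bullet> d = vy z \<bullet> d + 2 * (v z \<bullet> d) / Im z" "uy z \<bullet> d = - (vx z \<bullet> d)" if "z \<in> D" for z
    using fueter_system[OF that] by (simp_all add: inner_add_left)
qed (auto intro!: open_D convex_D D_pos continuous_intros continuous_partials)

text \<open>Equal values along two distinct directions force v = 0 and hence u = c on E;
  continuation in D is then applied to every real component.\<close>

lemma chart_unique_continuation:
  assumes E: "open E" "E \<subseteq> D" "E \<noteq> {}" and J: "J1 \<in> \<Lambda>" "J2 \<in> \<Lambda>" "J1 \<noteq> J2"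
    and c: "\<And>z. z \<in> E \<Longrightarrow> f (oct_pt z J1) = c" "\<And>z. z \<in> E \<Longrightarrow> f (oct_pt z J2) = c"
    and x: "x \<in> chart_dom"
  shows "f x = c"
proof -
  have uvE: "u z = c \<and> v z = 0" if z: "z \<in> E" for z
  proof -
    have zD: "z \<in> D" using z E by blast
    have "u z + J1 \<odot> v z = c" "u z + J2 \<odot> v z = c"
      using c[OF z] rep[OF zD] J by simp_all
    then have "(J1 - J2) \<odot> v z = 0" unfolding oct_mult.diff_left by (metis add_left_imp_eq cancel_comm_monoid_add_class.diff_cancel)
    moreover have "(J1 - J2) $ 0 = 0" using \<Lambda>_sphere J by (simp add: oct_sphere_iff)
    ultimately have "v z = 0" using oct_mult_eq_0_imag[of "J1 - J2"] J(3) by simp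
    then show ?thesis using \<open>u z + J1 \<odot> v z = c\<close> by (simp add: oct_mult.zero_right)
  qed
  have "u z \<bullet> d = c \<bullet> d \<and> v z \<bullet> d = 0" if "z \<in> D" for z d
    by (rule vekua.unique_continuation[OF vekua_component E _ _ that]) (use uvE in auto)
  then have uv: "u z = c" "v z = 0" if "z \<in> D" for z
    using that vector_eq_rdot[of "u z" c] vector_eq_rdot[of "v z" 0] by auto
  then show ?thesis
    using chart_rep[OF x] x by (simp add: chart_dom_def oct_mult.zero_right)
qed

text \<open>The term containing T \<odot> v is odd in t and cancels. The result is the same for
  every unit tangent T, so the frame vectors J and K \<odot> J contribute equally.\<close>

lemma chart_orthogonal_pair:
  assumes z: "z \<in> D" and K: "K \<in> \<Lambda>" and T: "T \<in> oct_sphere" "orthogonal K T"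
  shows "\<forall>\<^sub>F t in nhds 0. f (oct_pt z K + t *\<^sub>R T) \<bullet> c + f (oct_pt z K - t *\<^sub>R T) \<bullet> c =
    2 * (u (z + radial z t *\<^sub>R \<i>) \<bullet> c)
    + 2 * (Im z * ((K \<odot> v (z + radial z t *\<^sub>R \<i>)) \<bullet> c) / sqrt ((Im z)\<^sup>2 + t\<^sup>2))"
proof -
  have "- T \<in> oct_sphere" "orthogonal K (- T)" using T by (auto simp: oct_sphere_iff orthogonal_def)
  from chart_orthogonal_line[OF z K T] chart_orthogonal_line[OF z K this]
  show ?thesis
    by eventually_elim (simp add: inner_add_left oct_mult.add_left oct_mult.diff_left oct_mult.minus_left
        oct_mult.scaleR_left inner_diff_left add_divide_distrib diff_divide_distrib)
qed

lemma chart_harmonic: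
  assumes P: "P \<in> oct_orth_pairs" and z: "z \<in> D" and K: "K \<in> \<Lambda>" "K \<in> quat_slice P"
  shows "harmonic_at (quat_slice P) (\<lambda>x. f x \<bullet> c) (oct_pt z K)"
proof -
  have KS: "K \<in> oct_sphere" by (rule \<Lambda>_sphere[OF K(1)])
  obtain J where J: "J \<in> oct_sphere" "orthogonal K J" "span (quat_frame K J) = quat_slice P"
    using quat_slice_frame[OF P K(2) KS] by blast
  note F = quat_frame_orthonormal[OF KS J(1,2)]
  have dist: "oct_e 0 \<notin> {K, J, K \<odot> J}" "K \<notin> {J, K \<odot> J}" "J \<noteq> K \<odot> J"
    using F(3) by (auto simp: quat_frame_def card_insert_if split: if_splits)
  \<comment> \<open>Skewness moves K to the test vector. The component f \<bullet> c over the
    half-plane of K becomes u \<bullet> c + v \<bullet> d, a scalar part and a vector part tested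
    against different vectors.\<close>
  define d where "d = - (K \<odot> c)"
  have d: "(K \<odot> w) \<bullet> c = w \<bullet> d" for w
    using oct_mult_skew[of K w c] KS by (simp add: d_def oct_sphere_iff)
  let ?a = "\<lambda>z. u z \<bullet> c" and ?b = "\<lambda>z. v z \<bullet> d" and ?x = "oct_pt z K"
  let ?SA = "\<lambda>t. ?a (z + t *\<^sub>R 1) + ?a (z + (- t) *\<^sub>R 1) + (?a (z + t *\<^sub>R \<i>) + ?a (z + (- t) *\<^sub>R \<i>))
      + 4 * ?a (z + radial z t *\<^sub>R \<i>)"
  let ?SB = "\<lambda>t. ?b (z + t *\<^sub>R 1) + ?b (z + (- t) *\<^sub>R 1) + (?b (z + t *\<^sub>R \<i>) + ?b (z + (- t) *\<^sub>R \<i>))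
      + 4 * (Im z * ?b (z + radial z t *\<^sub>R \<i>) / sqrt ((Im z)\<^sup>2 + t\<^sup>2))"
  let ?L = "lines_sum (quat_frame K J) (\<lambda>x. f x \<bullet> c) ?x"
  obtain GA where GA: "\<forall>\<^sub>F t in nhds 0. (?SA has_real_derivative GA t) (at t)" "(GA has_real_derivative 0) (at 0)"
    using vekua.scalar_part_harmonic[OF vekua_component[of c] z] by blast
  obtain GB where GB: "\<forall>\<^sub>F t in nhds 0. (?SB has_real_derivative GB t) (at t)" "(GB has_real_derivative 0) (at 0)"
    using vekua.vector_part_harmonic[OF vekua_component[of d] z] by blast
  have fz: "f (oct_pt w K) \<bullet> c = ?a w + ?b w" if "w \<in> D" for w
    using rep[OF that K(1)] by (simp add: inner_add_left d)
  note ev = vekua.eventually_in_D[OF vekua_component[of c] z]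
  have "\<forall>\<^sub>F t in nhds 0. ?L t = ?SA t + ?SB t"
    using ev(1)[of 1] ev(2)[of 1] ev(1)[of \<i>] ev(2)[of \<i>]
      chart_orthogonal_pair[OF z K(1) J(1,2), of c]
      chart_orthogonal_pair[OF z K(1) oct_sphere_mult(1,2)[OF KS J(1,2)], of c]
  proof eventually_elim
    case (elim t)
    have "?x - t *\<^sub>R oct_e 0 = oct_pt (z + (- t) *\<^sub>R 1) K" "?x - t *\<^sub>R K = oct_pt (z + (- t) *\<^sub>R \<i>) K"
      using oct_pt_add_real[of z K "- t"] oct_pt_add_imag[of z K "- t"] by simp_all
    then have "?L t = f (oct_pt (z + t *\<^sub>R 1) K) \<bullet> c + f (oct_pt (z + (- t) *\<^sub>R 1) K) \<bullet> c
        + (f (oct_pt (z + t *\<^sub>R \<i>) K) \<bullet> c + f (oct_pt (z + (- t) *\<^sub>R \<i>) K) \<bullet> c)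
        + ((f (?x + t *\<^sub>R J) \<bullet> c + f (?x - t *\<^sub>R J) \<bullet> c)
        + (f (?x + t *\<^sub>R (K \<odot> J)) \<bullet> c + f (?x - t *\<^sub>R (K \<odot> J)) \<bullet> c))"
      unfolding lines_sum_def quat_frame_def
      using dist by (simp add: oct_pt_add_real oct_pt_add_imag)
    then show ?case
      unfolding fz[OF elim(1)] fz[OF elim(2)] fz[OF elim(3)] fz[OF elim(4)] elim(5) elim(6) d
      by linarith
  qed
  then obtain S where S: "open S" "0 \<in> S" "\<And>t. t \<in> S \<Longrightarrow> ?L t = ?SA t + ?SB t"
    unfolding eventually_nhds by blast
  have "\<forall>\<^sub>F t in nhds 0. t \<in> S" using S by (intro eventually_nhds_in_open)
  then have "\<forall>\<^sub>F t in nhds 0. (?L has_real_derivative GA t + GB t) (at t)"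
    using GA(1) GB(1)
  proof eventually_elim
    case (elim t)
    show ?case
      by (rule has_field_derivative_transform_within_open[OF DERIV_add[OF elim(2,3)] S(1) elim(1)])
        (simp add: S(3))
  qed
  moreover have "((\<lambda>t. GA t + GB t) has_real_derivative 0) (at 0)"
    using DERIV_add[OF GA(2) GB(2)] by simp
  ultimately have "pairwise orthogonal (quat_frame K J) \<and> (\<forall>x\<in>quat_frame K J. norm x = 1) \<and>
      span (quat_frame K J) = quat_slice P \<and>
      (\<forall>\<^sub>F t in nhds 0. (?L has_real_derivative GA t + GB t) (at t)) \<and>
      ((\<lambda>t. GA t + GB t) has_real_derivative 0) (at 0)"
    by (intro conjI ballI F(1,2) J(3))
  then show ?thesis
    unfolding harmonic_at_def by (intro exI)
qed

end

section \<open>Connected sets of directions and existence of charts\<close>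

lemma connected_oct_sphere: "connected oct_sphere"
proof -
  let ?P = "{x. oct_e 0 \<bullet> x = 0}"
  \<comment> \<open>The sphere is the radial projection of the imaginary hyperplane without 0;
    removing a point could disconnect it only in dimension 1.\<close>
  have "aff_dim ?P = 7"
    by (subst aff_dim_hyperplane) (auto simp: oct_e_def)
  then have "connected (?P - {0})"
    by (intro connected_punctured_convex convex_hyperplane) auto
  then have "connected ((\<lambda>x. x /\<^sub>R norm x) ` (?P - {0}))"
    by (rule connected_continuous_image[rotated]) (auto intro!: continuous_intros)
  also have "(\<lambda>x. x /\<^sub>R norm x) ` (?P - {0}) = oct_sphere"
  proof (intro equalityI subsetI)
    fix I assume "I \<in> oct_sphere"
    then show "I \<in> (\<lambda>x. x /\<^sub>R norm x) ` (?P - {0})"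
      by (intro image_eqI[of _ _ I]) (auto simp: oct_sphere_iff oct_Re_inner inner_commute)
  qed (auto simp: oct_sphere_iff oct_Re_inner inner_commute)
  finally show ?thesis .
qed

lemma connected_cap:
  assumes K: "K \<in> oct_sphere" and "0 \<le> \<kappa>"
  shows "connected {I \<in> oct_sphere. \<kappa> < I \<bullet> K}"
proof -
  \<comment> \<open>The cap is the radial projection of this cone, which is convex because \<kappa>
    \<ge> 0 makes \<kappa> times the norm convex. The strict inequality keeps 0 out.\<close>
  let ?C = "{x. x \<bullet> oct_e 0 = 0 \<and> \<kappa> * norm x < x \<bullet> K}"
  have nz: "x \<noteq> 0" if "x \<in> ?C" for x using that by auto
  have "convex ?C"
  proof (rule convexI)
    fix x y :: octonion and s t :: real
    assume xy: "x \<in> ?C" "y \<in> ?C" and st: "0 \<le> s" "0 \<le> t" "s + t = 1"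
    have "\<kappa> * norm (s *\<^sub>R x + t *\<^sub>R y) \<le> \<kappa> * (s * norm x + t * norm y)"
      using norm_triangle_ineq[of "s *\<^sub>R x" "t *\<^sub>R y"] st assms(2) by (intro mult_left_mono) auto
    also have "\<dots> = s * (\<kappa> * norm x) + t * (\<kappa> * norm y)" by (simp add: algebra_simps)
    also have "\<dots> < s * (x \<bullet> K) + t * (y \<bullet> K)"
    proof (cases "s = 0")
      case False
      then show ?thesis using xy st
        by (intro add_less_le_mono mult_strict_left_mono mult_left_mono) auto
    qed (use xy st in auto)
    finally show "s *\<^sub>R x + t *\<^sub>R y \<in> ?C" using xy by (simp add: inner_add_left)
  qed
  then have "connected ((\<lambda>x. x /\<^sub>R norm x) ` ?C)"
    by (intro connected_continuous_image convex_connected continuous_intros) (use nz in auto)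
  also have "(\<lambda>x. x /\<^sub>R norm x) ` ?C = {I \<in> oct_sphere. \<kappa> < I \<bullet> K}"
  proof (intro equalityI subsetI)
    fix I assume "I \<in> {I \<in> oct_sphere. \<kappa> < I \<bullet> K}"
    then show "I \<in> (\<lambda>x. x /\<^sub>R norm x) ` ?C"
      by (intro image_eqI[of _ _ I]) (auto simp: oct_sphere_iff oct_Re_inner)
  next
    fix I assume "I \<in> (\<lambda>x. x /\<^sub>R norm x) ` ?C"
    then obtain x where x: "x \<in> ?C" "I = x /\<^sub>R norm x" by blast
    then have "norm x > 0" using nz by simp
    then show "I \<in> {I \<in> oct_sphere. \<kappa> < I \<bullet> K}"
      using x by (auto simp: oct_sphere_iff oct_Re_inner field_simps)
  qed
  finally show ?thesis .
qed

lemma cap_point: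
  assumes "K \<in> oct_sphere" "J \<in> oct_sphere" "orthogonal K J" and s: "0 < s" "s < 1"
  defines "I \<equiv> sqrt (1 - s\<^sup>2) *\<^sub>R K + s *\<^sub>R J"
  shows "I \<in> oct_sphere" "I \<noteq> K" "I \<bullet> K = sqrt (1 - s\<^sup>2)"
proof -
  have KJ: "K \<bullet> K = 1" "J \<bullet> J = 1" "K \<bullet> J = 0" "J \<bullet> K = 0"
    using assms by (auto simp: oct_sphere_iff norm_eq_1 orthogonal_def inner_commute)
  have s2: "s\<^sup>2 < 1" using s by (simp add: abs_square_less_1)
  have "I \<bullet> I = (sqrt (1 - s\<^sup>2))\<^sup>2 + s\<^sup>2"
    by (simp add: I_def inner_add KJ power2_eq_square)
  also have "\<dots> = 1" using s2 by simp
  finally have "I \<bullet> I = 1" .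
  then show "I \<in> oct_sphere"
    using assms(1,2) by (simp add: oct_sphere_iff norm_eq_1 I_def)
  show "I \<bullet> K = sqrt (1 - s\<^sup>2)" by (simp add: I_def inner_add_left KJ)
  have "I \<bullet> J = s" by (simp add: I_def inner_add_left KJ)
  then show "I \<noteq> K" using KJ s by auto
qed

text \<open>Rotating K slightly inside H gives a second direction whose half-plane also meets the
  set where f = c, as unique continuation requires. H is a quaternionic slice in the maximum
  principle and the whole space in the identity principle.\<close>

lemma (in slice_chart) constant_near_slice_point:
  assumes H: "subspace H" "oct_e 0 \<in> H" "dim H > 2" and K: "K \<in> H" "K \<in> \<Lambda>" and z: "z \<in> D"
    and c: "\<forall>\<^sub>F x in nhds (oct_pt z K). x \<in> H \<longrightarrow> f x = c" and x: "x \<in> chart_dom"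
  shows "f x = c"
proof -
  have KS: "K \<in> oct_sphere" by (rule \<Lambda>_sphere[OF K(2)])
  obtain J where J: "J \<in> H" "J \<in> oct_sphere" "orthogonal K J"
    using exists_orthogonal_in_sphere[OF H K(1)] by blast
  obtain U where U: "open U" "oct_pt z K \<in> U" "\<And>x. x \<in> U \<Longrightarrow> x \<in> H \<Longrightarrow> f x = c"
    using c unfolding eventually_nhds by blast
  define I where "I = (\<lambda>s. sqrt (1 - s\<^sup>2) *\<^sub>R K + s *\<^sub>R J)"
  have "((\<lambda>s. oct_pt z (I s)) \<longlongrightarrow> oct_pt z (I 0)) (at_right 0)"
    unfolding oct_pt_def I_def by (intro tendsto_intros)
  then have "((\<lambda>s. oct_pt z (I s)) \<longlongrightarrow> oct_pt z K) (at_right 0)" by (simp add: I_def)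
  then have "\<forall>\<^sub>F s in at_right 0. oct_pt z (I s) \<in> U \<inter> chart_dom"
    by (rule topological_tendstoD) (use U open_chart_dom oct_pt_in_chart[OF z K(2)] in auto)
  moreover have "\<forall>\<^sub>F s in at_right 0. 0 < s \<and> s < (1::real)"
    by (auto simp: eventually_at_right[of 0 1] intro: exI[of _ 1])
  ultimately obtain s where s: "oct_pt z (I s) \<in> U" "oct_pt z (I s) \<in> chart_dom" "0 < s" "s < 1"
    using eventually_happens'[OF trivial_limit_at_right_real] eventually_conj by force
  have Is: "I s = sqrt (1 - s\<^sup>2) *\<^sub>R K + s *\<^sub>R J" by (simp add: I_def)
  note I = cap_point[OF KS J(2,3) s(3,4), folded Is]
  have "I s = oct_dir (oct_pt z (I s))" using oct_dir_pt[OF I(1) D_pos[OF z]] by simp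
  then have I\<Lambda>: "I s \<in> \<Lambda>" using s(2) by (simp add: chart_dom_def)
  have IH: "I s \<in> H" using H K J by (simp add: I_def subspace_add subspace_scale)
  have ptH: "oct_pt w L \<in> H" if "L \<in> H" for w L
    using that H by (simp add: oct_pt_def oct_of_real_def subspace_add subspace_scale)
  have contpt: "continuous_on D (\<lambda>w. oct_pt w L)" for L
    by (rule has_derivative_continuous_on[OF has_derivative_oct_pt])
  let ?E = "(D \<inter> (\<lambda>w. oct_pt w K) -` U) \<inter> (D \<inter> (\<lambda>w. oct_pt w (I s)) -` U)"
  show ?thesis
  proof (rule chart_unique_continuation[OF _ _ _ K(2) I\<Lambda> I(2)[symmetric] _ _ x])
    show "open ?E"
      by (intro open_Int continuous_open_preimage contpt open_D U(1))
    show "?E \<noteq> {}" using z U(2) s(1) by blast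
    show "f (oct_pt w K) = c" if "w \<in> ?E" for w using that U(3) ptH K(1) by auto
    show "f (oct_pt w (I s)) = c" if "w \<in> ?E" for w using that U(3) ptH IH by auto
  qed auto
qed

text \<open>For each z the connected set \<Lambda> lies in a single component of the corresponding
  \<open>slice_sphere\<close>, so one pair serves all of \<Lambda>; u and v arise by choosing such a
  pair for every z.\<close>

lemma slice_chart_exists:
  assumes reg: "slice_Fueter_regular \<Omega> f"
    and f': "\<And>x. x \<in> \<Omega> \<Longrightarrow> (f has_derivative blinfun_apply (f' x)) (at x)" "continuous_on \<Omega> f'"
    and D: "open D" "convex D" "\<And>z. z \<in> D \<Longrightarrow> Im z > 0"
    and \<Lambda>: "openin (top_of_set oct_sphere) \<Lambda>" "connected \<Lambda>" "I1 \<in> \<Lambda>" "I2 \<in> \<Lambda>" "I1 \<noteq> I2"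
    and sub: "\<And>z I. z \<in> D \<Longrightarrow> I \<in> \<Lambda> \<Longrightarrow> oct_pt z I \<in> \<Omega>"
  obtains u v where "slice_chart f f' D \<Lambda> u v I1 I2"
proof -
  have \<Lambda>S: "\<Lambda> \<subseteq> oct_sphere" using openin_imp_subset[OF \<Lambda>(1)] .
  have "\<exists>u v. \<forall>I\<in>\<Lambda>. f (oct_pt z I) = u + I \<odot> v" if z: "z \<in> D" for z
  proof -
    have sub': "\<Lambda> \<subseteq> slice_sphere \<Omega> (Re z) (Im z)"
      using sub[OF z] \<Lambda>S by (auto simp: slice_sphere_def oct_pt_def)
    then obtain C where "C \<in> components (slice_sphere \<Omega> (Re z) (Im z))" "\<Lambda> \<subseteq> C"
      using exists_component_superset[OF sub' _ \<Lambda>(2)] \<Lambda>(3) by auto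
    moreover have "slice_function \<Omega> f" using reg by (simp add: slice_Fueter_regular_def)
    ultimately obtain u v where "\<forall>I\<in>C. f (oct_of_real (Re z) + Im z *\<^sub>R I) = u + I \<odot> v"
      using D(3)[OF z] unfolding slice_function_def by blast
    with \<open>\<Lambda> \<subseteq> C\<close> show ?thesis unfolding oct_pt_def by blast
  qed
  then obtain u v where uv: "\<And>z I. z \<in> D \<Longrightarrow> I \<in> \<Lambda> \<Longrightarrow> f (oct_pt z I) = u z + I \<odot> v z"
    by metis
  have "slice_chart f f' D \<Lambda> u v I1 I2"
  proof
    show "continuous_on D (\<lambda>z. f' (oct_pt z I))" if "I \<in> \<Lambda>" for I
      by (rule continuous_on_compose2[OF f'(2) has_derivative_continuous_on[OF has_derivative_oct_pt]])
        (use sub that in auto)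
    show "dbar_F f (oct_pt z I) = 0" if z: "z \<in> D" and I: "I \<in> \<Lambda>" for z I
    proof -
      have "oct_Im (oct_pt z I) \<noteq> 0"
        using oct_Im_pt[of I z] \<Lambda>S I D(3)[OF z] by (auto simp: oct_sphere_iff)
      then have "oct_pt z I \<notin> range oct_of_real"
        by (auto simp: oct_of_real_def oct_Im_eq oct_e_nth)
      then show ?thesis
        using reg sub[OF z I] by (simp add: slice_Fueter_regular_def)
    qed
  qed (use assms uv in auto)
  then show ?thesis by (rule that)
qed

lemma norm_oct_pt:
  assumes "I \<in> oct_sphere"
  shows "norm (oct_pt w I) = cmod w"
proof -
  have "oct_e 0 \<bullet> I = 0" "I \<bullet> oct_e 0 = 0" "I \<bullet> I = 1" "oct_e 0 \<bullet> oct_e 0 = 1"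
    using assms by (auto simp: oct_sphere_iff oct_Re_inner inner_commute norm_eq_1[symmetric])
  then have "oct_pt w I \<bullet> oct_pt w I = (Re w)\<^sup>2 + (Im w)\<^sup>2"
    by (simp add: oct_pt_def oct_of_real_def inner_add power2_eq_square)
  then show ?thesis unfolding cmod_def norm_eq_sqrt_inner[of "oct_pt w I"] by simp
qed

lemma dist_oct_pt: "I \<in> oct_sphere \<Longrightarrow> dist (oct_pt z I) (oct_pt w I) = dist z w"
  by (simp add: dist_norm oct_pt_diff norm_oct_pt)

lemma oct_real_eq_pt: "oct_Im x = 0 \<Longrightarrow> x = oct_pt (of_real (x $ 0)) I"
  by (simp add: oct_Im_eq oct_pt_def oct_of_real_def)

section \<open>Charts of a given function and the identity principle\<close>

locale fueter_regular =
  fixes \<Omega> :: "octonion set" and f :: "octonion \<Rightarrow> octonion" and f' :: "octonion \<Rightarrow> octonion \<Rightarrow>\<^sub>L octonion"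
  assumes open_\<Omega>: "open \<Omega>" and regular: "slice_Fueter_regular \<Omega> f"
    and deriv: "\<And>x. x \<in> \<Omega> \<Longrightarrow> (f has_derivative blinfun_apply (f' x)) (at x)"
    and cont_deriv: "continuous_on \<Omega> f'"
begin

lemma chart_at_nonreal_point:
  assumes x: "x \<in> \<Omega>" "oct_Im x \<noteq> 0"
  obtains D \<Lambda> u v I1 I2 where "slice_chart f f' D \<Lambda> u v I1 I2" "oct_zeta x \<in> D" "oct_dir x \<in> \<Lambda>"
proof -
  define z K where "z = oct_zeta x" and "K = oct_dir x"
  have KS: "K \<in> oct_sphere" using oct_dir_sphere[OF x(2)] by (simp add: K_def)
  have zK: "oct_pt z K = x" using oct_pt_zeta_dir[OF x(2)] by (simp add: z_def K_def)
  have y: "Im z > 0" using x(2) by (simp add: z_def oct_zeta_def)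
  have "continuous_on UNIV (\<lambda>p. oct_pt (fst p) (snd p))"
    unfolding oct_pt_def oct_of_real_def by (intro continuous_intros)
  then have "open ((\<lambda>p. oct_pt (fst p) (snd p)) -` \<Omega>)"
    using continuous_on_open_vimage[OF open_UNIV] open_\<Omega> by auto
  then obtain A B where AB: "open A" "open B" "(z, K) \<in> A \<times> B" "A \<times> B \<subseteq> (\<lambda>p. oct_pt (fst p) (snd p)) -` \<Omega>"
    using zK x(1) by (elim open_prod_elim[of _ "(z, K)"]) auto
  have "open (A \<inter> {z. 0 < Im z})" using AB(1) by (intro open_Int open_halfspace_Im_gt)
  then obtain e where e: "e > 0" "ball z e \<subseteq> A \<inter> {z. 0 < Im z}"
    using AB(3) y openE[of "A \<inter> {z. 0 < Im z}" z] by auto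
  obtain d where d: "d > 0" "ball K d \<subseteq> B" using AB(2,3) openE[of B K] by auto
  \<comment> \<open>For unit vectors |K - I|^2 = 2 - 2 I \<bullet> K, so I \<bullet> K > 1 - d^2 / 2
    puts I within d of K; the maximum with 0 is what connectedness of the cap needs.\<close>
  define \<kappa> where "\<kappa> = max 0 (1 - d\<^sup>2 / 2)"
  define \<Lambda> where "\<Lambda> = {I \<in> oct_sphere. \<kappa> < I \<bullet> K}"
  have KK: "K \<bullet> K = 1" using KS by (simp add: oct_sphere_iff norm_eq_1)
  have \<kappa>: "0 \<le> \<kappa>" "\<kappa> < 1" using d by (auto simp: \<kappa>_def)
  have \<Lambda>B: "I \<in> B" if "I \<in> \<Lambda>" for I
  proof -
    have "I \<bullet> I = 1" using that by (simp add: \<Lambda>_def oct_sphere_iff norm_eq_1)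
    then have "(norm (K - I))\<^sup>2 = 2 - 2 * (I \<bullet> K)"
      unfolding power2_norm_eq_inner by (simp add: inner_diff KK inner_commute[of K I])
    also have "\<dots> < d\<^sup>2" using that by (auto simp: \<Lambda>_def \<kappa>_def)
    finally have "norm (K - I) < d" using d(1) by (intro power_less_imp_less_base[of _ 2 d]) auto
    then show ?thesis using d(2) by (auto simp: dist_norm)
  qed
  have "openin (top_of_set oct_sphere) (oct_sphere \<inter> {I. \<kappa> < I \<bullet> K})"
    by (intro openin_open_Int open_Collect_less continuous_intros)
  moreover have "oct_sphere \<inter> {I. \<kappa> < I \<bullet> K} = \<Lambda>" by (auto simp: \<Lambda>_def)
  ultimately have openin: "openin (top_of_set oct_sphere) \<Lambda>" by simp
  have K\<Lambda>: "K \<in> \<Lambda>" using KS KK \<kappa> by (simp add: \<Lambda>_def)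
  obtain J where J: "J \<in> oct_sphere" "orthogonal K J"
    using exists_orthogonal_in_sphere[of UNIV K] by auto
  \<comment> \<open>With this s the rotated unit has inner product with K equal to the square root
    of (1 + \<kappa>^2) / 2, which exceeds \<kappa>: a second point of the cap.\<close>
  define s where "s = sqrt ((1 - \<kappa>\<^sup>2) / 2)"
  have k2: "\<kappa>\<^sup>2 < 1" using \<kappa> by (simp add: abs_square_less_1)
  have s2: "s\<^sup>2 = (1 - \<kappa>\<^sup>2) / 2" using k2 by (simp add: s_def)
  have s: "0 < s" using k2 by (simp add: s_def)
  have "s\<^sup>2 \<le> 1 / 2" unfolding s2 by simp
  then have "s\<^sup>2 < 1" by simp
  then have s': "s < 1" using s by (simp add: abs_square_less_1)
  define I where "I = sqrt (1 - s\<^sup>2) *\<^sub>R K + s *\<^sub>R J"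
  note I = cap_point[OF KS J s s', folded I_def]
  have "\<kappa> < sqrt (1 - s\<^sup>2)"
    by (rule real_less_rsqrt) (use k2 in \<open>simp add: s2 field_simps\<close>)
  then have I\<Lambda>: "I \<in> \<Lambda>" using I by (simp add: \<Lambda>_def)
  obtain u v where "slice_chart f f' (ball z e) \<Lambda> u v I K"
  proof (rule slice_chart_exists[OF regular deriv cont_deriv _ _ _ openin _ I\<Lambda> K\<Lambda> I(2)])
    show "connected \<Lambda>" unfolding \<Lambda>_def by (rule connected_cap[OF KS \<kappa>(1)])
    show "oct_pt w L \<in> \<Omega>" if "w \<in> ball z e" "L \<in> \<Lambda>" for w L
      using AB(4) e(2) \<Lambda>B[OF that(2)] that(1) by fastforce
    show "Im w > 0" if "w \<in> ball z e" for w using e(2) that by auto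
  qed auto
  then show ?thesis
    by (rule that) (use e K\<Lambda> in \<open>auto simp: z_def K_def\<close>)
qed

text \<open>A real centre lies on every half-plane and \<open>oct_pt\<close> preserves distances in
  each of them. A half-disc times the whole, connected sphere therefore covers all nonreal points of
  a ball.\<close>

lemma chart_at_real_point:
  assumes x: "x \<in> \<Omega>" "oct_Im x = 0"
  obtains D \<Lambda> u v I1 I2 r where "slice_chart f f' D \<Lambda> u v I1 I2" "r > 0" "ball x r \<subseteq> \<Omega>"
    "\<And>y. y \<in> ball x r \<Longrightarrow> oct_Im y \<noteq> 0 \<Longrightarrow> oct_zeta y \<in> D \<and> oct_dir y \<in> \<Lambda>"
proof -
  define a :: complex where "a = of_real (x $ 0)"
  have xa: "x = oct_pt a I" for I using oct_real_eq_pt[OF x(2)] by (simp add: a_def)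
  obtain r where r: "r > 0" "ball x r \<subseteq> \<Omega>" using openE[OF open_\<Omega> x(1)] by blast
  let ?D = "ball a r \<inter> {z. 0 < Im z}"
  have e: "oct_e 1 \<in> oct_sphere" "oct_e 2 \<in> oct_sphere" "oct_e 1 \<noteq> oct_e 2"
    by (auto simp: oct_sphere_iff oct_e_nth oct_eq_iff)
  obtain u v where chart: "slice_chart f f' ?D oct_sphere u v (oct_e 1) (oct_e 2)"
  proof (rule slice_chart_exists[OF regular deriv cont_deriv _ _ _ _ connected_oct_sphere e])
    show "oct_pt w L \<in> \<Omega>" if "w \<in> ?D" "L \<in> oct_sphere" for w L
      using that r(2) dist_oct_pt[OF that(2), of a w] xa[of L] by auto
  qed (auto intro: open_halfspace_Im_gt convex_Int convex_halfspace_Im_gt)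
  have "oct_zeta y \<in> ?D \<and> oct_dir y \<in> oct_sphere" if y: "y \<in> ball x r" "oct_Im y \<noteq> 0" for y
  proof -
    note S = oct_dir_sphere[OF y(2)]
    have "dist a (oct_zeta y) = dist x y"
      using dist_oct_pt[OF S, of a "oct_zeta y"] xa[of "oct_dir y"] oct_pt_zeta_dir[OF y(2)] by simp
    then show ?thesis using y S by (auto simp: oct_zeta_def)
  qed
  then show ?thesis using that[OF chart r] by blast
qed

lemma nonreal_in_open:
  assumes "open U" "x \<in> U"
  obtains y where "y \<in> U" "oct_Im y \<noteq> 0"
proof (cases "oct_Im x = 0")
  case True
  obtain e where e: "e > 0" "ball x e \<subseteq> U" using openE[OF assms] by blast
  let ?y = "x + (e / 2) *\<^sub>R oct_e 1"
  have "?y \<in> U" using e by (intro subsetD[OF e(2)]) (simp add: dist_norm)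
  moreover have "oct_Im ?y $ 1 \<noteq> 0"
    using arg_cong[OF True, of "\<lambda>v :: octonion. v $ 1"] e(1) by (simp add: oct_Im_eq oct_e_nth)
  then have "oct_Im ?y \<noteq> 0" by (metis zero_index)
  ultimately show ?thesis by (rule that)
qed (use assms that in auto)

lemma continuous_f: "x \<in> \<Omega> \<Longrightarrow> isCont f x"
  using deriv has_derivative_continuous by blast

text \<open>The interior of the set where f = c is open and closed relative to \<Omega>. At a real
  limit point the chart settles the nonreal points of a ball, and their density with continuity of f
  settles the real ones.\<close>

lemma identity_principle:
  assumes "connected \<Omega>" and x0: "x0 \<in> \<Omega>" and c: "\<forall>\<^sub>F x in nhds x0. f x = c" and x: "x \<in> \<Omega>"
  shows "f x = c"
proof -
  define W where "W = interior {x. f x = c}"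
  have W: "open W" "\<And>y. y \<in> W \<Longrightarrow> f y = c"
    unfolding W_def using interior_subset by auto
  have WI: "y \<in> W" if "open V" "y \<in> V" "\<And>w. w \<in> V \<Longrightarrow> f w = c" for V y
    unfolding W_def using that by (intro interiorI[of V]) auto
  have ev: "\<forall>\<^sub>F w in nhds y. w \<in> UNIV \<longrightarrow> f w = c" if "y \<in> W" for y
    using eventually_nhds_in_open[OF W(1) that] by eventually_elim (simp add: W)
  have whole_chart: "f w = c" if chart: "slice_chart f f' D \<Lambda> u v I1 I2"
    and y: "y \<in> W" "oct_Im y \<noteq> 0" "oct_zeta y \<in> D" "oct_dir y \<in> \<Lambda>"
    and w: "oct_Im w \<noteq> 0" "oct_zeta w \<in> D" "oct_dir w \<in> \<Lambda>" for D \<Lambda> u v I1 I2 w y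
  proof (rule slice_chart.constant_near_slice_point[OF chart, of UNIV])
    show "\<forall>\<^sub>F x in nhds (oct_pt (oct_zeta y) (oct_dir y)). x \<in> UNIV \<longrightarrow> f x = c"
      using ev[OF y(1)] oct_pt_zeta_dir[OF y(2)] by simp
    show "w \<in> slice_chart.chart_dom D \<Lambda>"
      using w by (simp add: slice_chart.chart_dom_def[OF chart])
  qed (use y in auto)
  have closed: "y \<in> W" if y: "y \<in> \<Omega>" "y \<in> closure W" for y
  proof (cases "oct_Im y = 0")
    case False
    obtain D \<Lambda> u v I1 I2 where chart: "slice_chart f f' D \<Lambda> u v I1 I2" "oct_zeta y \<in> D" "oct_dir y \<in> \<Lambda>"
      by (rule chart_at_nonreal_point[OF y(1) False])
    let ?N = "slice_chart.chart_dom D \<Lambda>"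
    note N = slice_chart.chart_dom_def[OF chart(1)]
    have yN: "y \<in> ?N" using False chart by (simp add: N)
    note oN = slice_chart.open_chart_dom[OF chart(1)]
    obtain w where w: "w \<in> W" "w \<in> ?N"
      using y(2) yN open_Int_closure_eq_empty[OF oN, of W] by blast
    show ?thesis
    proof (rule WI[OF oN yN])
      fix t assume "t \<in> ?N"
      then show "f t = c" using whole_chart[OF chart(1) w(1), of t] w(2) by (simp add: N)
    qed
  next
    case True
    obtain D \<Lambda> u v I1 I2 r where chart: "slice_chart f f' D \<Lambda> u v I1 I2" "r > 0" "ball y r \<subseteq> \<Omega>"
      and inD: "\<And>w. w \<in> ball y r \<Longrightarrow> oct_Im w \<noteq> 0 \<Longrightarrow> oct_zeta w \<in> D \<and> oct_dir w \<in> \<Lambda>"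
      by (rule chart_at_real_point[OF y(1) True]) blast
    have "y \<in> ball y r" using chart(2) by simp
    then obtain w0 where w0: "w0 \<in> W \<inter> ball y r"
      using y(2) open_Int_closure_eq_empty[OF open_ball, of y r W] by blast
    obtain w where w: "w \<in> W \<inter> ball y r" "oct_Im w \<noteq> 0"
      by (rule nonreal_in_open[OF open_Int[OF W(1) open_ball] w0])
    \<comment> \<open>One chart contains all nonreal points of the ball, so a single nonreal point
      of W decides f on all of them.\<close>
    have nonreal: "f t = c" if "t \<in> ball y r" "oct_Im t \<noteq> 0" for t
      using whole_chart[OF chart(1), of w t] w inD[of w] inD[of t] that by auto
    show ?thesis
    proof (rule WI[OF open_ball \<open>y \<in> ball y r\<close>])
      fix t assume t: "t \<in> ball y r"
      show "f t = c"
      proof (rule ccontr)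
        assume ne: "f t \<noteq> c"
        have "continuous_on (ball y r) f"
          using continuous_f chart(3) by (intro continuous_at_imp_continuous_on) auto
        then have "open (ball y r \<inter> f -` (- {c}))"
          by (intro continuous_open_preimage) auto
        then obtain t' where "t' \<in> ball y r \<inter> f -` (- {c})" "oct_Im t' \<noteq> 0"
          by (rule nonreal_in_open[of _ t]) (use t ne in auto)
        then show False using nonreal by auto
      qed
    qed
  qed
  \<comment> \<open>f is a total function, so W may reach outside \<Omega>; clopenness is stated for
    the trace on \<Omega>.\<close>
  have "\<Omega> \<inter> W = \<Omega> \<inter> closure W" using closed closure_subset by auto
  then have "closedin (top_of_set \<Omega>) (\<Omega> \<inter> W)" by (simp add: closedin_closed_Int)
  moreover have "openin (top_of_set \<Omega>) (\<Omega> \<inter> W)" using W(1) by (simp add: openin_open_Int)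
  ultimately have "\<Omega> \<inter> W = {} \<or> \<Omega> \<inter> W = \<Omega>"
    using assms(1) by (auto simp: connected_clopen)
  moreover obtain S where "open S" "x0 \<in> S" "\<And>w. w \<in> S \<Longrightarrow> f w = c"
    using c unfolding eventually_nhds by blast
  then have "x0 \<in> W" by (rule WI)
  ultimately show ?thesis using x x0 W(2) by blast
qed

end

section \<open>The maximum principle\<close>

text \<open>The equality case of Cauchy-Schwarz. It recovers the value of f from its component in
  the direction c.\<close>

lemma inner_unit_eq_norm:
  fixes x c :: "'a::real_inner"
  assumes "norm c = 1" "norm x \<le> m" "x \<bullet> c = m"
  shows "x = m *\<^sub>R c"
proof -
  have "(norm (x - m *\<^sub>R c))\<^sup>2 = (norm x)\<^sup>2 - m\<^sup>2"
    using assms(1,3) unfolding power2_norm_eq_inner norm_eq_1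
    by (simp add: inner_diff inner_commute[of c x] power2_eq_square)
  also have "\<dots> \<le> 0" using assms(2) by (simp add: power_mono)
  finally show ?thesis by simp
qed

context fueter_regular
begin

lemma harmonic_on_quat_slice:
  assumes P: "P \<in> oct_orth_pairs" and w: "w \<in> \<Omega>" "w \<in> quat_slice P" "oct_Im w \<noteq> 0"
  shows "harmonic_at (quat_slice P) (\<lambda>x. f x \<bullet> c) w"
proof -
  obtain D \<Lambda> u v I1 I2 where chart: "slice_chart f f' D \<Lambda> u v I1 I2" "oct_zeta w \<in> D" "oct_dir w \<in> \<Lambda>"
    by (rule chart_at_nonreal_point[OF w(1,3)])
  have "oct_dir w \<in> quat_slice P"
    using quat_slice_properties(1,2)[OF P] w(2)
    by (simp add: oct_dir_def oct_Im_eq subspace_diff subspace_scale)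
  from slice_chart.chart_harmonic[OF chart(1) P chart(2,3) this] show ?thesis
    by (simp add: oct_pt_zeta_dir[OF w(3)])
qed

text \<open>Only the open ball has to avoid the axis within the slice: differentiability at y comes
  from the C^1 assumption, so y itself may be real.\<close>

lemma hopf_on_quat_slice:
  assumes P: "P \<in> oct_orth_pairs" and q: "q \<in> quat_slice P" and y: "y \<in> quat_slice P" "dist y q = r" "r > 0"
    and sub: "cball q r \<subseteq> \<Omega>"
    and nonreal: "\<And>x. x \<in> quat_slice P \<Longrightarrow> dist x q < r \<Longrightarrow> oct_Im x \<noteq> 0"
    and less: "\<And>x. x \<in> quat_slice P \<Longrightarrow> dist x q < r \<Longrightarrow> f x \<bullet> c < M"
    and le: "\<And>x. x \<in> quat_slice P \<Longrightarrow> dist x q = r \<Longrightarrow> f x \<bullet> c \<le> M"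
    and yM: "f y \<bullet> c = M" and max: "\<forall>\<^sub>F x in nhds y. x \<in> quat_slice P \<longrightarrow> f x \<bullet> c \<le> M"
  shows False
proof (rule hopf_boundary_point[OF quat_slice_properties(1)[OF P] q y(1) _ y(3) _ _ _ _ yM _ max])
  have "y \<in> \<Omega>" using sub y(2) by (auto simp: dist_commute)
  then show "((\<lambda>x. f x \<bullet> c) has_derivative (\<lambda>h. f' y h \<bullet> c)) (at y)"
    by (intro has_derivative_inner_left deriv)
  show "continuous_on (quat_slice P \<inter> cball q r) (\<lambda>x. f x \<bullet> c)"
    using sub continuous_f
    by (intro continuous_on_inner continuous_on_const continuous_at_imp_continuous_on) auto
  show "harmonic_at (quat_slice P) (\<lambda>x. f x \<bullet> c) x" if "x \<in> quat_slice P" "norm (x - q) < r" for x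
    using that sub nonreal[of x] by (intro harmonic_on_quat_slice[OF P]) (auto simp: dist_norm norm_minus_commute)
qed (use y less le in \<open>auto simp: dist_norm\<close>)

lemma local_max_nonreal_imp_constant:
  assumes "connected \<Omega>" and P: "P \<in> oct_orth_pairs"
    and p: "p \<in> \<Omega>" "p \<in> quat_slice P" "oct_Im p \<noteq> 0"
    and max: "\<forall>\<^sub>F x in nhds p. x \<in> quat_slice P \<longrightarrow> norm (f x) \<le> norm (f p)"
  shows "f constant_on \<Omega>"
proof -
  let ?H = "quat_slice P"
  note H = quat_slice_properties[OF P]
  define \<mu> where "\<mu> = norm (f p)"
  have "open (\<Omega> \<inter> {x. oct_Im x \<noteq> 0})"
    by (intro open_Int open_\<Omega> open_Collect_neq continuous_oct_Im continuous_intros)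
  then have "\<forall>\<^sub>F x in nhds p. x \<in> \<Omega> \<inter> {x. oct_Im x \<noteq> 0}"
    using p by (intro eventually_nhds_in_open) auto
  from eventually_conj[OF this max] obtain d where d: "d > 0"
    and ball: "\<And>x. dist x p < d \<Longrightarrow> x \<in> \<Omega> \<and> oct_Im x \<noteq> 0"
    and le: "\<And>x. dist x p < d \<Longrightarrow> x \<in> ?H \<Longrightarrow> norm (f x) \<le> \<mu>"
    unfolding eventually_nhds_metric \<mu>_def by blast
  \<comment> \<open>For x within d / 2 of p the ball about x through p stays within d of p, where f
    is controlled. If \<mu> = 0 the bound alone gives f = 0.\<close>
  have eq: "f x = f p" if x: "x \<in> ?H" "dist x p < d / 2" for x
  proof (cases "\<mu> = 0")
    case True
    then show ?thesis using le[of x] x d by (auto simp: \<mu>_def)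
  next
    case False
    define c where "c = f p /\<^sub>R \<mu>"
    have c: "norm c = 1" "f p \<bullet> c = \<mu>" "f p = \<mu> *\<^sub>R c"
      using False by (auto simp: c_def \<mu>_def power2_norm_eq_inner[symmetric] power2_eq_square)
    have le': "f y \<bullet> c \<le> \<mu>" if "dist y p < d" "y \<in> ?H" for y
      using Cauchy_Schwarz_ineq2[of "f y" c] le[OF that] c(1) by simp
    define R where "R = dist p x"
    have R: "R < d / 2" using x by (simp add: R_def dist_commute)
    have near: "dist y p < d" if "dist y x \<le> R" for y
      using dist_triangle[of y p x] that R by (simp add: R_def dist_commute)
    \<comment> \<open>The points of this ball where the component attains \<mu>, with p among them.
      If its point y nearest to x were not x, the open ball about x reaching to y would meet no
      maximum point inside the slice, against Hopf's lemma.\<close>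
    define C where "C = (?H \<inter> cball x R) \<inter> (\<lambda>y. f y \<bullet> c) -` {\<mu>}"
    have CH: "compact (?H \<inter> cball x R)"
      by (intro closed_Int_compact closed_subspace H compact_cball)
    have "continuous_on (?H \<inter> cball x R) (\<lambda>y. f y \<bullet> c)"
      using ball near continuous_f
      by (intro continuous_on_inner continuous_on_const continuous_at_imp_continuous_on) (auto simp: dist_commute)
    then have "closed C" unfolding C_def
      by (intro continuous_closed_preimage compact_imp_closed CH) auto
    moreover have "p \<in> C" using p(2) c(2) by (simp add: C_def R_def dist_commute)
    ultimately obtain y where y: "y \<in> C" "\<And>w. w \<in> C \<Longrightarrow> dist x y \<le> dist x w"
      using distance_attains_inf[of C x] by blast
    have yC: "y \<in> ?H" "dist y x \<le> R" "f y \<bullet> c = \<mu>" using y(1) by (auto simp: C_def dist_commute)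
    have "y = x"
    proof (rule ccontr)
      assume "y \<noteq> x"
      have far: "dist w p < d" if "dist w x \<le> dist y x" for w using near[of w] that yC(2) by simp
      show False
      proof (rule hopf_on_quat_slice[OF P x(1) yC(1) refl])
        show "0 < dist y x" using \<open>y \<noteq> x\<close> by simp
        show "cball x (dist y x) \<subseteq> \<Omega>" using ball far by (auto simp: dist_commute)
        show "oct_Im w \<noteq> 0" if "w \<in> ?H" "dist w x < dist y x" for w using ball far that by auto
        show "f w \<bullet> c \<le> \<mu>" if "w \<in> ?H" "dist w x = dist y x" for w using le' far that by auto
        show "f w \<bullet> c < \<mu>" if "w \<in> ?H" "dist w x < dist y x" for w
        proof -
          have "w \<notin> C" using y(2)[of w] that by (auto simp: dist_commute)
          then have "f w \<bullet> c \<noteq> \<mu>" using that yC(2) by (auto simp: C_def dist_commute)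
          then show ?thesis using le'[OF far that(1)] that by auto
        qed
        have "open (ball p d)" "y \<in> ball p d" using far[of y] by (auto simp: dist_commute)
        then have "\<forall>\<^sub>F w in nhds y. w \<in> ball p d" by (intro eventually_nhds_in_open)
        then show "\<forall>\<^sub>F w in nhds y. w \<in> ?H \<longrightarrow> f w \<bullet> c \<le> \<mu>"
          by eventually_elim (simp add: le' dist_commute)
      qed (rule yC(3))
    qed
    then have "f x \<bullet> c = \<mu>" using yC by simp
    then have "f x = \<mu> *\<^sub>R c" using inner_unit_eq_norm[OF c(1)] le[of x] x d by simp
    then show ?thesis using c(3) by simp
  qed
  obtain D \<Lambda> u v I1 I2 where chart: "slice_chart f f' D \<Lambda> u v I1 I2" "oct_zeta p \<in> D" "oct_dir p \<in> \<Lambda>"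
    by (rule chart_at_nonreal_point[OF p(1,3)])
  let ?N = "slice_chart.chart_dom D \<Lambda>"
  have pN: "p \<in> ?N" using chart p(3) by (simp add: slice_chart.chart_dom_def[OF chart(1)])
  have const: "f x = f p" if "x \<in> ?N" for x
  proof (rule slice_chart.constant_near_slice_point[OF chart(1) H(1,2) _ _ chart(3,2) _ that])
    show "oct_dir p \<in> ?H"
      using H(1,2) p(2) by (simp add: oct_dir_def oct_Im_eq subspace_diff subspace_scale)
    have "\<forall>\<^sub>F x in nhds p. x \<in> ball p (d / 2)"
      using d by (intro eventually_nhds_in_open) auto
    then show "\<forall>\<^sub>F x in nhds (oct_pt (oct_zeta p) (oct_dir p)). x \<in> ?H \<longrightarrow> f x = f p"
      unfolding oct_pt_zeta_dir[OF p(3)] by eventually_elim (simp add: eq dist_commute)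
  qed (simp add: H)
  have "\<forall>\<^sub>F x in nhds p. f x = f p"
    using eventually_nhds_in_open[OF slice_chart.open_chart_dom[OF chart(1)] pN] by eventually_elim (rule const)
  then show ?thesis
    using identity_principle[OF assms(1) p(1)] unfolding constant_on_def by blast
qed

text \<open>For real p there are two cases. If some nearby nonreal point of the slice attains \<mu>,
  it is itself a local maximum and the nonreal case applies. Otherwise the inequality is strict at
  nearby nonreal points, which is the strictness Hopf's lemma asks for inside the ball.\<close>

lemma local_max_imp_constant:
  assumes "connected \<Omega>" and P: "P \<in> oct_orth_pairs" and p: "p \<in> \<Omega>" "p \<in> quat_slice P"
    and max: "\<forall>\<^sub>F x in nhds p. x \<in> quat_slice P \<longrightarrow> norm (f x) \<le> norm (f p)"
  shows "f constant_on \<Omega>"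
proof (cases "oct_Im p = 0")
  case False
  then show ?thesis by (rule local_max_nonreal_imp_constant[OF assms(1) P p _ max])
next
  case True
  let ?H = "quat_slice P"
  note H = quat_slice_properties[OF P]
  define \<mu> where "\<mu> = norm (f p)"
  have "\<forall>\<^sub>F x in nhds p. x \<in> \<Omega>" using p open_\<Omega> by (intro eventually_nhds_in_open)
  from eventually_conj[OF this max] obtain d where d: "d > 0"
    and ball: "\<And>x. dist x p < d \<Longrightarrow> x \<in> \<Omega>"
    and le: "\<And>x. dist x p < d \<Longrightarrow> x \<in> ?H \<Longrightarrow> norm (f x) \<le> \<mu>"
    unfolding eventually_nhds_metric \<mu>_def by blast
  show ?thesis
  proof (cases "\<exists>w\<in>?H. dist w p < d \<and> oct_Im w \<noteq> 0 \<and> norm (f w) = \<mu>")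
    case True
    then obtain w where w: "w \<in> ?H" "dist w p < d" "oct_Im w \<noteq> 0" "norm (f w) = \<mu>" by blast
    have "\<forall>\<^sub>F x in nhds w. x \<in> ball p d"
      using w(2) by (intro eventually_nhds_in_open) (auto simp: dist_commute)
    then have "\<forall>\<^sub>F x in nhds w. x \<in> ?H \<longrightarrow> norm (f x) \<le> norm (f w)"
      by eventually_elim (simp add: w(4) le dist_commute)
    then show ?thesis using local_max_nonreal_imp_constant[OF assms(1) P] ball w by blast
  next
    case False
    then have strict: "norm (f x) < \<mu>" if "x \<in> ?H" "dist x p < d" "oct_Im x \<noteq> 0" for x
      using le[of x] that by fastforce
    obtain K where K: "K \<in> ?H" "K \<in> oct_sphere" using H(5) by blast
    \<comment> \<open>The centre is displaced perpendicularly to the axis by exactly the radius, so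
      the ball touches the axis at p. Radius d / 4 keeps the closed ball within d of p.\<close>
    define q where "q = p + (d / 4) *\<^sub>R K"
    have qH: "q \<in> ?H" using H(1) K p(2) by (simp add: q_def subspace_add subspace_scale)
    have pq: "dist p q = d / 4" using K d by (simp add: q_def dist_norm oct_sphere_iff)
    have near: "dist x p < d" if "dist x q \<le> d / 4" for x
      using dist_triangle[of x p q] that pq d by (simp add: dist_commute)
    have nonreal: "oct_Im x \<noteq> 0" if "dist x q < d / 4" for x
    proof
      assume "oct_Im x = 0"
      \<comment> \<open>The perpendicular distance from q to the real axis is d / 4, so no real
        point lies in the open ball.\<close>
      then have "oct_Im (q - x) = (d / 4) *\<^sub>R K"
        using True K by (simp add: q_def oct_Im_eq oct_sphere_iff algebra_simps)
      then have "oct_Im (q - x) \<bullet> K = d / 4" using K by (simp add: oct_sphere_iff norm_eq_1)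
      moreover have "oct_Im (q - x) \<bullet> K = (q - x) \<bullet> K"
        using K by (simp add: oct_Im_eq oct_sphere_iff oct_Re_inner inner_diff_left inner_commute[of "oct_e 0" K])
      ultimately have "d / 4 \<le> norm (q - x)"
        using Cauchy_Schwarz_ineq2[of "q - x" K] K by (simp add: oct_sphere_iff)
      then show False using that by (simp add: dist_norm norm_minus_commute)
    qed
    \<comment> \<open>Strictness at the nonreal point q shows that \<mu> is positive, so f p can be
      normalized.\<close>
    have "norm (f q) < \<mu>"
      using strict[OF qH] near[of q] nonreal[of q] d by simp
    then have \<mu>: "\<mu> > 0" by (rule le_less_trans[OF norm_ge_zero])
    define c where "c = f p /\<^sub>R \<mu>"
    have c: "norm c = 1" "f p \<bullet> c = \<mu>"
      using \<mu> by (auto simp: c_def \<mu>_def power2_norm_eq_inner[symmetric] power2_eq_square)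
    have cs: "f x \<bullet> c \<le> norm (f x)" for x
      using Cauchy_Schwarz_ineq2[of "f x" c] c(1) by simp
    have False
    proof (rule hopf_on_quat_slice[OF P qH p(2) pq])
      show "0 < d / 4" using d by simp
      show "cball q (d / 4) \<subseteq> \<Omega>" using near ball by (auto simp: dist_commute)
      show "oct_Im x \<noteq> 0" if "x \<in> ?H" "dist x q < d / 4" for x by (rule nonreal[OF that(2)])
      show "f x \<bullet> c < \<mu>" if "x \<in> ?H" "dist x q < d / 4" for x
        using cs[of x] strict[OF that(1) near nonreal] that by simp
      show "f x \<bullet> c \<le> \<mu>" if "x \<in> ?H" "dist x q = d / 4" for x
        using cs[of x] le[OF near that(1)] that by simp
      show "\<forall>\<^sub>F x in nhds p. x \<in> ?H \<longrightarrow> f x \<bullet> c \<le> \<mu>"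
        using max by eventually_elim (use cs order_trans in \<open>auto simp: \<mu>_def\<close>)
    qed (rule c(2))
    then show ?thesis ..
  qed
qed

end

theorem theorem3p13:
  fixes \<Omega> :: "octonion set" and f :: "octonion \<Rightarrow> octonion"
  assumes "open \<Omega>" and "connected \<Omega>" and "\<Omega> \<noteq> {}"
    and "slice_Fueter_regular \<Omega> f"
    and "\<not> f constant_on \<Omega>"
  shows "\<forall>P \<in> oct_orth_pairs.
    \<not> (\<exists>p. local_max_on (\<lambda>x. norm (f x)) (\<Omega> \<inter> quat_slice P) p)"
proof (intro ballI notI)
  fix P assume P: "P \<in> oct_orth_pairs"
    and "\<exists>p. local_max_on (\<lambda>x. norm (f x)) (\<Omega> \<inter> quat_slice P) p"
  then obtain p where p: "p \<in> \<Omega>" "p \<in> quat_slice P"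
    and max: "\<forall>\<^sub>F y in at p within \<Omega> \<inter> quat_slice P. norm (f y) \<le> norm (f p)"
    by (auto simp: local_max_on_def)
  obtain f' :: "octonion \<Rightarrow> octonion \<Rightarrow>\<^sub>L octonion" where
    "\<And>x. x \<in> \<Omega> \<Longrightarrow> (f has_derivative blinfun_apply (f' x)) (at x)" "continuous_on \<Omega> f'"
    using assms(4) by (auto simp: slice_Fueter_regular_def C1_on_def)
  then interpret fueter_regular \<Omega> f f'
    using assms(1,4) by unfold_locales auto
  \<comment> \<open>The inequality is trivial at p, and \<Omega> is a neighbourhood of p, so the
    punctured filter within \<Omega> may be replaced by the neighbourhoods of p in the
    slice.\<close>
  have "\<forall>\<^sub>F y in nhds p. y \<noteq> p \<longrightarrow> y \<in> \<Omega> \<inter> quat_slice P \<longrightarrow> norm (f y) \<le> norm (f p)"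
    using max by (simp add: eventually_at_filter)
  moreover have "\<forall>\<^sub>F y in nhds p. y \<in> \<Omega>" using p assms(1) by (intro eventually_nhds_in_open)
  ultimately have "\<forall>\<^sub>F y in nhds p. y \<in> quat_slice P \<longrightarrow> norm (f y) \<le> norm (f p)"
    by eventually_elim auto
  then have "f constant_on \<Omega>" by (rule local_max_imp_constant[OF assms(2) P p])
  with assms(5) show False ..
qed

end
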